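(* For every countable structure $\mathcal{A}$ in a countable vocabulary, $SR(\mathcal{A})=SR(\mathcal{T}_{\mathcal{A}})$, where $\mathcal{T}_{\mathcal{A}}$ is the tree of tuples of $\mathcal{A}$.
   Context: Infinitary formulas: $\Sigma^{\mathrm{in}}_0=\Pi^{\mathrm{in}}_0$ are the finitary quantifier-free formulas; for $\alpha\ge1$, a $\Sigma^{\mathrm{in}}_\alpha$ formula is a countable disjunction of formulas $\exists\bar x\,\varphi$ with $\varphi\in\Pi^{\mathrm{in}}_\beta$, $\beta<\alpha$, and $\Pi^{\mathrm{in}}_\alpha$ is dual. The (parameterless) Scott rank $SR(\mathcal{M})$ of a countable structure $\mathcal{M}$ is the least ordinal $\alpha$ such that the automorphism orbit of every finite tuple of $\mathcal{M}$ is definable in $\mathcal{M}$ by a $\Sigma^{\mathrm{in}}_\alpha$ formula without parameters. Tree of tuples: let $T_{\mathcal{A}}$ be the tree of all finite tuples of $\mathcal{A}$ ordered by extension (root the empty tuple), each tuple labeled by a natural number coding its length and its finite atomic diagram. $\mathcal{T}_{\mathcal{A}}$ is obtained by replicating every branch of $T_{\mathcal{A}}$ infinitely many times, so that for every node $\sigma$ with parent $\tau$ there are infinitely many children $\tilde\sigma$ of $\tau$ whose labeled subtrees above them are isomorphic to that above $\sigma$. It is viewed as a structure in the vocabulary of labeled trees (tree order, parent function, labeling $l:T\to\omega$).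
   Formalization: Equality is proved when SR(A) ≥ 1; when SR(A)=0 only SR(T_A) ≤ 1 is claimed, as equality can fail there (e.g. ω with predicates P_i={i}). A length-n tuple's label codes the truth values of the first n atomic formulas in any fixed enumeration. *)

theory Defs
  imports "HOL-Library.Countable_Set" "HOL-Library.Sublist"
begin

subsection \<open>Countable ordinals\<close>

text \<open>The elements of the first uncountable initial ordinal, i.e. exactly the countable ordinals.\<close>

typedef omega1 = "Field (cardSuc natLeq)"
proof -
  have "infinite (Field (cardSuc natLeq))"
    using cardSuc_finite[OF natLeq_Card_order] by (simp add: Field_natLeq)
  then have "Field (cardSuc natLeq) \<noteq> {}" by (metis finite.emptyI)
  then show ?thesis by blast
qed

lemma omega1_Well_order: "Well_order (cardSuc natLeq)"
  using cardSuc_Card_order[OF natLeq_Card_order] by (rule Card_order_wo_rel[unfolded wo_rel_def])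

instantiation omega1 :: wellorder
begin

definition less_eq_omega1 :: "omega1 \<Rightarrow> omega1 \<Rightarrow> bool"
  where "\<alpha> \<le> \<beta> \<longleftrightarrow> (Rep_omega1 \<alpha>, Rep_omega1 \<beta>) \<in> cardSuc natLeq"

definition less_omega1 :: "omega1 \<Rightarrow> omega1 \<Rightarrow> bool"
  where "\<alpha> < \<beta> \<longleftrightarrow> \<alpha> \<le> \<beta> \<and> \<not> \<beta> \<le> (\<alpha>::omega1)"

instance
proof
  let ?r = "cardSuc natLeq"
  have refl: "refl_on (Field ?r) ?r" and trans: "trans ?r" and antisym: "antisym ?r"
    and total: "Total ?r" and wf: "wf (?r - Id)"
    using omega1_Well_order
    by (auto simp: well_order_on_def linear_order_on_def partial_order_on_def preorder_on_def)
  fix x y z :: omega1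
  show "(x < y) = (x \<le> y \<and> \<not> y \<le> x)" by (rule less_omega1_def)
  show xx: "x \<le> x" for x :: omega1
    using refl Rep_omega1 by (auto simp: less_eq_omega1_def refl_on_def)
  show "x \<le> z" if "x \<le> y" "y \<le> z"
    using that trans by (auto simp: less_eq_omega1_def elim: transE)
  show anti: "x = y" if "x \<le> y" "y \<le> x" for x y :: omega1
    using that antisym by (auto simp: less_eq_omega1_def Rep_omega1_inject dest: antisymD)
  show "x \<le> y \<or> y \<le> x"
    using total Rep_omega1[of x] Rep_omega1[of y] xx[of x]
    by (cases "x = y") (auto simp: less_eq_omega1_def total_on_def Rep_omega1_inject)
  show "P a" if step: "\<And>x. (\<And>y. y < x \<Longrightarrow> P y) \<Longrightarrow> P x" for P and a :: omega1
  proof -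
    have "wf (inv_image (?r - Id) Rep_omega1)" using wf by (rule wf_inv_image)
    then show ?thesis
    proof (induction a rule: wf_induct_rule)
      case (less x)
      show ?case
        by (rule step, rule less)
          (auto simp: in_inv_image less_omega1_def less_eq_omega1_def Rep_omega1_inject)
    qed
  qed
qed

end

instantiation omega1 :: "{zero, one}"
begin

definition zero_omega1 :: omega1 where "0 = (LEAST \<alpha>::omega1. True)"
definition one_omega1 :: omega1 where "1 = (LEAST \<alpha>::omega1. 0 < \<alpha>)"

instance ..

end

subsection \<open>Vocabularies and structures\<close>

record ('f, 'r) vocabulary =
  Funs :: "'f set"
  Rels :: "'r set"
  fun_arity :: "'f \<Rightarrow> nat"
  rel_arity :: "'r \<Rightarrow> nat"

definition countable_vocabulary :: "('f, 'r) vocabulary \<Rightarrow> bool"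
  where "countable_vocabulary V \<longleftrightarrow> countable (Funs V) \<and> countable (Rels V)"

text \<open>Constants are function symbols of arity 0. Interpretations are only meaningful on
  argument lists over the universe of the right length.\<close>

record ('a, 'f, 'r) model =
  univ :: "'a set"
  fun_int :: "'f \<Rightarrow> 'a list \<Rightarrow> 'a"
  rel_int :: "'r \<Rightarrow> 'a list \<Rightarrow> bool"

definition tuples :: "('a, 'f, 'r) model \<Rightarrow> nat \<Rightarrow> 'a list set"
  where "tuples M n = {as \<in> lists (univ M). length as = n}"

definition is_model :: "('f, 'r) vocabulary \<Rightarrow> ('a, 'f, 'r) model \<Rightarrow> bool"
  where "is_model V M \<longleftrightarrow> univ M \<noteq> {} \<and>
    (\<forall>f\<in>Funs V. \<forall>as\<in>tuples M (fun_arity V f). fun_int M f as \<in> univ M)"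

definition automorphism :: "('f, 'r) vocabulary \<Rightarrow> ('a, 'f, 'r) model \<Rightarrow> ('a \<Rightarrow> 'a) \<Rightarrow> bool"
  where "automorphism V M g \<longleftrightarrow> bij_betw g (univ M) (univ M) \<and>
    (\<forall>f\<in>Funs V. \<forall>as\<in>tuples M (fun_arity V f). g (fun_int M f as) = fun_int M f (map g as)) \<and>
    (\<forall>r\<in>Rels V. \<forall>as\<in>tuples M (rel_arity V r). rel_int M r (map g as) \<longleftrightarrow> rel_int M r as)"

definition orbit :: "('f, 'r) vocabulary \<Rightarrow> ('a, 'f, 'r) model \<Rightarrow> 'a list \<Rightarrow> 'a list set"
  where "orbit V M as = {map g as | g. automorphism V M g}"

subsection \<open>Finitary quantifier-free formulas\<close>

datatype 'f tm = Var nat | App 'f "'f tm list"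

primrec tm_vars :: "'f tm \<Rightarrow> nat set"
where
  "tm_vars (Var i) = {i}"
| "tm_vars (App f ts) = \<Union> (set (map tm_vars ts))"

primrec tm_in :: "('f, 'r) vocabulary \<Rightarrow> 'f tm \<Rightarrow> bool"
where
  "tm_in V (Var i) \<longleftrightarrow> True"
| "tm_in V (App f ts) \<longleftrightarrow> f \<in> Funs V \<and> length ts = fun_arity V f \<and> list_all (tm_in V) ts"

primrec tm_val :: "('a, 'f, 'r) model \<Rightarrow> (nat \<Rightarrow> 'a) \<Rightarrow> 'f tm \<Rightarrow> 'a"
where
  "tm_val M v (Var i) = v i"
| "tm_val M v (App f ts) = fun_int M f (map (tm_val M v) ts)"

datatype ('f, 'r) atom = Eq "'f tm" "'f tm" | Rel 'r "'f tm list"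

primrec atom_vars :: "('f, 'r) atom \<Rightarrow> nat set"
where
  "atom_vars (Eq s t) = tm_vars s \<union> tm_vars t"
| "atom_vars (Rel r ts) = (\<Union>t\<in>set ts. tm_vars t)"

primrec atom_in :: "('f, 'r) vocabulary \<Rightarrow> ('f, 'r) atom \<Rightarrow> bool"
where
  "atom_in V (Eq s t) \<longleftrightarrow> tm_in V s \<and> tm_in V t"
| "atom_in V (Rel r ts) \<longleftrightarrow> r \<in> Rels V \<and> length ts = rel_arity V r \<and> (\<forall>t\<in>set ts. tm_in V t)"

primrec atom_sat :: "('a, 'f, 'r) model \<Rightarrow> (nat \<Rightarrow> 'a) \<Rightarrow> ('f, 'r) atom \<Rightarrow> bool"
where
  "atom_sat M v (Eq s t) \<longleftrightarrow> tm_val M v s = tm_val M v t"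
| "atom_sat M v (Rel r ts) \<longleftrightarrow> rel_int M r (map (tm_val M v) ts)"

datatype ('f, 'r) qf = Bot | Atom "('f, 'r) atom" | Neg "('f, 'r) qf"
  | And "('f, 'r) qf" "('f, 'r) qf" | Or "('f, 'r) qf" "('f, 'r) qf"

primrec qf_vars :: "('f, 'r) qf \<Rightarrow> nat set"
where
  "qf_vars Bot = {}"
| "qf_vars (Atom a) = atom_vars a"
| "qf_vars (Neg p) = qf_vars p"
| "qf_vars (And p q) = qf_vars p \<union> qf_vars q"
| "qf_vars (Or p q) = qf_vars p \<union> qf_vars q"

primrec qf_in :: "('f, 'r) vocabulary \<Rightarrow> ('f, 'r) qf \<Rightarrow> bool"
where
  "qf_in V Bot \<longleftrightarrow> True"
| "qf_in V (Atom a) \<longleftrightarrow> atom_in V a"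
| "qf_in V (Neg p) \<longleftrightarrow> qf_in V p"
| "qf_in V (And p q) \<longleftrightarrow> qf_in V p \<and> qf_in V q"
| "qf_in V (Or p q) \<longleftrightarrow> qf_in V p \<and> qf_in V q"

primrec qf_sat :: "('a, 'f, 'r) model \<Rightarrow> (nat \<Rightarrow> 'a) \<Rightarrow> ('f, 'r) qf \<Rightarrow> bool"
where
  "qf_sat M v Bot \<longleftrightarrow> False"
| "qf_sat M v (Atom a) \<longleftrightarrow> atom_sat M v a"
| "qf_sat M v (Neg p) \<longleftrightarrow> \<not> qf_sat M v p"
| "qf_sat M v (And p q) \<longleftrightarrow> qf_sat M v p \<and> qf_sat M v q"
| "qf_sat M v (Or p q) \<longleftrightarrow> qf_sat M v p \<or> qf_sat M v q"

subsection \<open>The infinitary hierarchy\<close>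

text \<open>\<open>OrEx X F\<close> is the countable disjunction over \<open>n\<close> of the formulas \<open>\<exists>x\<^sub>1 \<dots> x\<^sub>k. F n\<close> with
  \<open>X n = [x\<^sub>1, \<dots>, x\<^sub>k]\<close>, and \<open>AndAll X F\<close> is its dual. Finite disjunctions (conjunctions)
  are obtained by repeating members, the empty ones by taking \<open>Bot\<close> (\<open>Neg Bot\<close>)
  for every member.\<close>

datatype ('f, 'r) fm = QF "('f, 'r) qf"
  | OrEx "nat \<Rightarrow> nat list" "nat \<Rightarrow> ('f, 'r) fm"
  | AndAll "nat \<Rightarrow> nat list" "nat \<Rightarrow> ('f, 'r) fm"

primrec fm_vars :: "('f, 'r) fm \<Rightarrow> nat set"
where
  "fm_vars (QF p) = qf_vars p"
| "fm_vars (OrEx X F) = (\<Union>n. fm_vars (F n) - set (X n))"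
| "fm_vars (AndAll X F) = (\<Union>n. fm_vars (F n) - set (X n))"

primrec fm_in :: "('f, 'r) vocabulary \<Rightarrow> ('f, 'r) fm \<Rightarrow> bool"
where
  "fm_in V (QF p) \<longleftrightarrow> qf_in V p"
| "fm_in V (OrEx X F) \<longleftrightarrow> (\<forall>n. fm_in V (F n))"
| "fm_in V (AndAll X F) \<longleftrightarrow> (\<forall>n. fm_in V (F n))"

definition reassign :: "('a, 'f, 'r) model \<Rightarrow> nat list \<Rightarrow> (nat \<Rightarrow> 'a) \<Rightarrow> (nat \<Rightarrow> 'a) set"
  where "reassign M xs v = {w. \<forall>i. if i \<in> set xs then w i \<in> univ M else w i = v i}"

primrec fm_sat :: "('a, 'f, 'r) model \<Rightarrow> (nat \<Rightarrow> 'a) \<Rightarrow> ('f, 'r) fm \<Rightarrow> bool"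
where
  "fm_sat M v (QF p) \<longleftrightarrow> qf_sat M v p"
| "fm_sat M v (OrEx X F) \<longleftrightarrow> (\<exists>n. \<exists>w\<in>reassign M (X n) v. fm_sat M w (F n))"
| "fm_sat M v (AndAll X F) \<longleftrightarrow> (\<forall>n. \<forall>w\<in>reassign M (X n) v. fm_sat M w (F n))"

inductive Sigma_in :: "omega1 \<Rightarrow> ('f, 'r) fm \<Rightarrow> bool"
  and Pi_in :: "omega1 \<Rightarrow> ('f, 'r) fm \<Rightarrow> bool"
where
  Sigma_0: "Sigma_in 0 (QF p)"
| Pi_0: "Pi_in 0 (QF p)"
| Sigma_step: "0 < \<alpha> \<Longrightarrow> (\<And>n. \<exists>\<beta><\<alpha>. Pi_in \<beta> (F n)) \<Longrightarrow> Sigma_in \<alpha> (OrEx X F)"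
| Pi_step: "0 < \<alpha> \<Longrightarrow> (\<And>n. \<exists>\<beta><\<alpha>. Sigma_in \<beta> (F n)) \<Longrightarrow> Pi_in \<alpha> (AndAll X F)"

subsection \<open>Parameterless Scott rank\<close>

text \<open>The tuple \<open>as\<close> is assigned to the variables \<open>0, \<dots>, length as - 1\<close>; the values of
  \<open>(!) as\<close> beyond its length are irrelevant because of the condition on the free variables.\<close>

definition Sigma_definable ::
  "('f, 'r) vocabulary \<Rightarrow> ('a, 'f, 'r) model \<Rightarrow> omega1 \<Rightarrow> nat \<Rightarrow> 'a list set \<Rightarrow> bool"
  where "Sigma_definable V M \<alpha> n S \<longleftrightarrow>
    (\<exists>\<phi>. Sigma_in \<alpha> \<phi> \<and> fm_in V \<phi> \<and> fm_vars \<phi> \<subseteq> {..<n} \<and>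
         S = {as \<in> tuples M n. fm_sat M ((!) as) \<phi>})"

definition scott_rank :: "('f, 'r) vocabulary \<Rightarrow> ('a, 'f, 'r) model \<Rightarrow> omega1"
  where "scott_rank V M =
    (LEAST \<alpha>. \<forall>as\<in>lists (univ M). Sigma_definable V M \<alpha> (length as) (orbit V M as))"

subsection \<open>Labelled trees\<close>

text \<open>The labelling \<open>l\<close> with values in the natural numbers is rendered by the unary predicates
  \<open>l(x) = n\<close>. Trees are prefix-closed sets of lists; the root is its own parent.\<close>

datatype tree_fun = Parent
datatype tree_rel = Below | Label nat

definition tree_vocabulary :: "(tree_fun, tree_rel) vocabulary"
  where "tree_vocabulary = \<lparr>Funs = UNIV, Rels = UNIV, fun_arity = (\<lambda>_. 1),
    rel_arity = (\<lambda>r. case r of Below \<Rightarrow> 2 | Label n \<Rightarrow> 1)\<rparr>"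

definition labelled_tree ::
  "'b list set \<Rightarrow> ('b list \<Rightarrow> nat) \<Rightarrow> ('b list, tree_fun, tree_rel) model"
  where "labelled_tree T l = \<lparr>univ = T,
    fun_int = (\<lambda>_ xs. butlast (xs ! 0)),
    rel_int = (\<lambda>r xs. case r of Below \<Rightarrow> prefix (xs ! 0) (xs ! 1) | Label n \<Rightarrow> l (xs ! 0) = n)\<rparr>"

text \<open>Every step of a branch carries a copy number: the nodes \<open>\<tau> @ [(a, k)]\<close>, for varying \<open>k\<close>,
  are the infinitely many copies of a child, with isomorphic labelled subtrees above them.\<close>

definition replicated_tree ::
  "'b list set \<Rightarrow> ('b list \<Rightarrow> nat) \<Rightarrow> (('b \<times> nat) list, tree_fun, tree_rel) model"
  where "replicated_tree T l = labelled_tree {\<sigma>. map fst \<sigma> \<in> T} (\<lambda>\<sigma>. l (map fst \<sigma>))"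

subsection \<open>The tree of tuples\<close>

text \<open>The finite atomic diagram of a tuple of length \<open>n\<close> records the truth values of the first \<open>n\<close>
  atomic formulas in a fixed enumeration \<open>e\<close> of all atomic formulas of the vocabulary; a
  formula with a variable that is not assigned by the tuple gets the value \<open>False\<close>.\<close>

definition enumerates_atoms :: "('f, 'r) vocabulary \<Rightarrow> (nat \<Rightarrow> ('f, 'r) atom) \<Rightarrow> bool"
  where "enumerates_atoms V e \<longleftrightarrow> range e = {a. atom_in V a}"

definition finite_diagram ::
  "(nat \<Rightarrow> ('f, 'r) atom) \<Rightarrow> ('a, 'f, 'r) model \<Rightarrow> 'a list \<Rightarrow> bool list"
  where "finite_diagram e A as =
    map (\<lambda>i. atom_vars (e i) \<subseteq> {..<length as} \<and> atom_sat A ((!) as) (e i)) [0..<length as]"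

definition tuple_label :: "(nat \<Rightarrow> ('f, 'r) atom) \<Rightarrow> ('a, 'f, 'r) model \<Rightarrow> 'a list \<Rightarrow> nat"
  where "tuple_label e A as = to_nat (length as, finite_diagram e A as)"

definition tree_of_tuples ::
  "(nat \<Rightarrow> ('f, 'r) atom) \<Rightarrow> ('a, 'f, 'r) model \<Rightarrow> (('a \<times> nat) list, tree_fun, tree_rel) model"
  where "tree_of_tuples e A = replicated_tree (lists (univ A)) (tuple_label e A)"

end

theory Submission
  imports Defs
begin

text \<open>
  A node of the tree is a tuple of \<open>A\<close> together with a list of copy numbers, so \<open>\<T>\<^sub>A\<close> is interpreted in
  \<open>A\<close>: for fixed copy numbers, atomic facts about nodes are finitary quantifier-free facts about the
  tuples, and a quantifier over nodes is a countable disjunction of quantifiers over tuples.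
  Hence \<open>\<Sigma>\<^sub>\<alpha>\<close> relations of the tree pull back to \<open>\<Sigma>\<^sub>\<alpha>\<close> relations of \<open>A\<close> for every \<open>\<alpha>\<close>.
  Conversely, an existential quantifier over \<open>A\<close> is a quantifier over the extensions of a node, and a
  quantifier-free condition is read off the label of any sufficiently long extension; so for \<open>\<alpha> \<ge> 1\<close> a
  \<open>\<Sigma>\<^sub>\<alpha>\<close> relation of \<open>A\<close> gives a \<open>\<Sigma>\<^sub>\<alpha>\<close> set of nodes.
  Two back-and-forth arguments match the orbits: two tuples of nodes lie in the same orbit iff they
  have the same finite tree structure and corresponding nodes carry tuples in the same orbit of \<open>A\<close>.
  So the two structures have orbits definable at exactly the same levels \<open>\<alpha> \<ge> 1\<close>, and definability at
  level \<open>0\<close> passes from the tree to \<open>A\<close>.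
\<close>

section \<open>Formulas\<close>

lemma tm_val_cong: "(\<And>i. i \<in> tm_vars t \<Longrightarrow> v i = w i) \<Longrightarrow> tm_val M v t = tm_val M w t"
proof (induction t)
  case (App f ts)
  then have "map (tm_val M v) ts = map (tm_val M w) ts"
    by (auto intro!: map_cong)
  then show ?case by (simp only: tm_val.simps)
qed simp

lemma atom_sat_cong:
  assumes "\<And>i. i \<in> atom_vars a \<Longrightarrow> v i = w i"
  shows "atom_sat M v a = atom_sat M w a"
proof (cases a)
  case (Eq s t)
  then have "tm_val M v s = tm_val M w s" "tm_val M v t = tm_val M w t"
    using assms by (auto intro: tm_val_cong)
  then show ?thesis using Eq by simp
next
  case (Rel r ts)
  then have "map (tm_val M v) ts = map (tm_val M w) ts"
    using assms by (auto intro!: map_cong tm_val_cong)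
  then show ?thesis using Rel by (simp only: atom_sat.simps)
qed

lemma qf_sat_cong: "(\<And>i. i \<in> qf_vars p \<Longrightarrow> v i = w i) \<Longrightarrow> qf_sat M v p = qf_sat M w p"
proof (induction p)
  case (Atom a)
  then show ?case using atom_sat_cong[of a v w M] by simp
next
  case (And p q)
  then have "qf_sat M v p = qf_sat M w p" "qf_sat M v q = qf_sat M w q" by simp_all
  then show ?case by simp
next
  case (Or p q)
  then have "qf_sat M v p = qf_sat M w p" "qf_sat M v q = qf_sat M w q" by simp_all
  then show ?case by simp
qed simp_all

lemma Bex_reassign_cong:
  assumes Q: "\<And>u u'. (\<And>i. i \<in> B \<Longrightarrow> u i = u' i) \<Longrightarrow> Q u = Q u'"
    and vw: "\<And>i. i \<in> B - set xs \<Longrightarrow> v i = w i"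
  shows "(\<exists>u\<in>reassign M xs v. Q u) \<longleftrightarrow> (\<exists>u\<in>reassign M xs w. Q u)"
proof -
  have transfer: "\<exists>u\<in>reassign M xs w. Q u"
    if u: "u \<in> reassign M xs v" "Q u" and vw: "\<And>i. i \<in> B - set xs \<Longrightarrow> v i = w i" for u v w
  proof
    let ?u = "\<lambda>i. if i \<in> set xs then u i else w i"
    show "?u \<in> reassign M xs w" using u(1) by (auto simp: reassign_def split: if_splits)
    have "Q u = Q ?u"
      using u(1) vw by (intro Q) (auto simp: reassign_def split: if_splits)
    then show "Q ?u" using u(2) by simp
  qed
  show ?thesis
    using transfer[of _ v w] transfer[of _ w v] vw vw[symmetric] by blast
qed

lemma fm_sat_cong: "(\<And>i. i \<in> fm_vars \<phi> \<Longrightarrow> v i = w i) \<Longrightarrow> fm_sat M v \<phi> = fm_sat M w \<phi>"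
proof (induction \<phi> arbitrary: v w)
  case (QF p)
  then show ?case using qf_sat_cong[of p v w M] by simp
next
  case (OrEx X F)
  have "(\<exists>u\<in>reassign M (X n) v. fm_sat M u (F n)) \<longleftrightarrow> (\<exists>u\<in>reassign M (X n) w. fm_sat M u (F n))" for n
    using OrEx.prems by (intro Bex_reassign_cong[OF OrEx.IH[OF rangeI]]) auto
  then show ?case by simp
next
  case (AndAll X F)
  have neg_cong: "(\<not> fm_sat M u (F n)) = (\<not> fm_sat M u' (F n))"
    if "\<And>i. i \<in> fm_vars (F n) \<Longrightarrow> u i = u' i" for n u u'
    using AndAll.IH[OF rangeI that] by simp
  have "(\<exists>u\<in>reassign M (X n) v. \<not> fm_sat M u (F n)) \<longleftrightarrow>
      (\<exists>u\<in>reassign M (X n) w. \<not> fm_sat M u (F n))" for n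
    by (rule Bex_reassign_cong[OF neg_cong]) (use AndAll.prems in auto)
  then show ?case by auto
qed

primrec tm_rename :: "(nat \<Rightarrow> nat) \<Rightarrow> 'f tm \<Rightarrow> 'f tm"
where
  "tm_rename \<rho> (Var i) = Var (\<rho> i)"
| "tm_rename \<rho> (App f ts) = App f (map (tm_rename \<rho>) ts)"

primrec atom_rename :: "(nat \<Rightarrow> nat) \<Rightarrow> ('f, 'r) atom \<Rightarrow> ('f, 'r) atom"
where
  "atom_rename \<rho> (Eq s t) = Eq (tm_rename \<rho> s) (tm_rename \<rho> t)"
| "atom_rename \<rho> (Rel r ts) = Rel r (map (tm_rename \<rho>) ts)"

primrec qf_rename :: "(nat \<Rightarrow> nat) \<Rightarrow> ('f, 'r) qf \<Rightarrow> ('f, 'r) qf"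
where
  "qf_rename \<rho> Bot = Bot"
| "qf_rename \<rho> (Atom a) = Atom (atom_rename \<rho> a)"
| "qf_rename \<rho> (Neg p) = Neg (qf_rename \<rho> p)"
| "qf_rename \<rho> (And p q) = And (qf_rename \<rho> p) (qf_rename \<rho> q)"
| "qf_rename \<rho> (Or p q) = Or (qf_rename \<rho> p) (qf_rename \<rho> q)"

lemma tm_vars_rename: "tm_vars (tm_rename \<rho> t) = \<rho> ` tm_vars t"
  by (induction t) auto

lemma tm_in_rename: "tm_in V (tm_rename \<rho> t) = tm_in V t"
  by (induction t) (auto simp: list_all_iff)

lemma tm_val_rename: "tm_val M v (tm_rename \<rho> t) = tm_val M (\<lambda>i. v (\<rho> i)) t"
proof (induction t)
  case (App f ts)
  then have "map (tm_val M v) (map (tm_rename \<rho>) ts) = map (tm_val M (\<lambda>i. v (\<rho> i))) ts" by auto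
  then show ?case by (simp del: map_map)
qed simp

lemma atom_vars_rename: "atom_vars (atom_rename \<rho> a) = \<rho> ` atom_vars a"
  by (cases a) (auto simp: tm_vars_rename)

lemma atom_in_rename: "atom_in V (atom_rename \<rho> a) = atom_in V a"
  by (cases a) (auto simp: tm_in_rename)

lemma atom_sat_rename: "atom_sat M v (atom_rename \<rho> a) = atom_sat M (\<lambda>i. v (\<rho> i)) a"
proof (cases a)
  case (Rel r ts)
  have "map (tm_val M v) (map (tm_rename \<rho>) ts) = map (tm_val M (\<lambda>i. v (\<rho> i))) ts"
    by (simp add: tm_val_rename)
  then show ?thesis using Rel by (simp del: map_map)
qed (simp add: tm_val_rename)

lemma qf_vars_rename: "qf_vars (qf_rename \<rho> p) = \<rho> ` qf_vars p"
  by (induction p) (auto simp: atom_vars_rename)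

lemma qf_in_rename: "qf_in V (qf_rename \<rho> p) = qf_in V p"
  by (induction p) (auto simp: atom_in_rename)

lemma qf_sat_rename: "qf_sat M v (qf_rename \<rho> p) = qf_sat M (\<lambda>i. v (\<rho> i)) p"
  by (induction p) (auto simp: atom_sat_rename)

lemma finite_tm_vars: "finite (tm_vars t)"
  by (induction t) auto

lemma finite_atom_vars: "finite (atom_vars a)"
  by (cases a) (auto simp: finite_tm_vars)

primrec fm_dual :: "('f, 'r) fm \<Rightarrow> ('f, 'r) fm"
where
  "fm_dual (QF p) = QF (Neg p)"
| "fm_dual (OrEx X F) = AndAll X (\<lambda>n. fm_dual (F n))"
| "fm_dual (AndAll X F) = OrEx X (\<lambda>n. fm_dual (F n))"

lemma fm_vars_dual [simp]: "fm_vars (fm_dual \<phi>) = fm_vars \<phi>"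
  by (induction \<phi>) auto

lemma fm_in_dual [simp]: "fm_in V (fm_dual \<phi>) \<longleftrightarrow> fm_in V \<phi>"
  by (induction \<phi>) auto

lemma fm_sat_dual [simp]: "fm_sat M v (fm_dual \<phi>) \<longleftrightarrow> \<not> fm_sat M v \<phi>"
  by (induction \<phi> arbitrary: v) auto

lemma Pi_in_dual: "Sigma_in \<alpha> \<phi> \<Longrightarrow> Pi_in \<alpha> (fm_dual \<phi>)"
  and Sigma_in_dual: "Pi_in \<alpha> \<phi> \<Longrightarrow> Sigma_in \<alpha> (fm_dual \<phi>)"
proof (induction rule: Sigma_in_Pi_in.inducts)
  case (Sigma_step \<alpha> F X)
  then have "\<exists>\<beta><\<alpha>. Sigma_in \<beta> (fm_dual (F n))" for n by blast
  then show ?case using \<open>0 < \<alpha>\<close> by (simp add: Sigma_in_Pi_in.Pi_step)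
next
  case (Pi_step \<alpha> F X)
  then have "\<exists>\<beta><\<alpha>. Pi_in \<beta> (fm_dual (F n))" for n by blast
  then show ?case using \<open>0 < \<alpha>\<close> by (simp add: Sigma_in_Pi_in.Sigma_step)
qed (simp_all add: Sigma_in_Pi_in.intros)

section \<open>Quantifier-free definable relations\<close>

definition qf_definable ::
  "('f, 'r) vocabulary \<Rightarrow> ('a, 'f, 'r) model \<Rightarrow> nat \<Rightarrow> ('a list \<Rightarrow> bool) \<Rightarrow> bool"
  where "qf_definable V M n P \<longleftrightarrow>
    (\<exists>p. qf_in V p \<and> qf_vars p \<subseteq> {..<n} \<and> (\<forall>as\<in>tuples M n. qf_sat M ((!) as) p \<longleftrightarrow> P as))"

lemma qf_definableE:
  assumes "qf_definable V M n P"
  obtains p where "qf_in V p" "qf_vars p \<subseteq> {..<n}" "\<forall>as\<in>tuples M n. qf_sat M ((!) as) p \<longleftrightarrow> P as"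
  using assms unfolding qf_definable_def by blast

lemma qf_definable_cong:
  "qf_definable V M n P \<Longrightarrow> (\<And>as. as \<in> tuples M n \<Longrightarrow> P as \<longleftrightarrow> Q as) \<Longrightarrow> qf_definable V M n Q"
  unfolding qf_definable_def by metis

lemma qf_definable_const: "qf_definable V M n (\<lambda>_. b)"
  unfolding qf_definable_def
  by (cases b; rule exI[of _ "if b then Neg Bot else Bot"]) auto

lemma qf_definable_not: "qf_definable V M n P \<Longrightarrow> qf_definable V M n (\<lambda>as. \<not> P as)"
  unfolding qf_definable_def by (metis qf_in.simps(3) qf_sat.simps(3) qf_vars.simps(3))

lemma qf_definable_conj:
  assumes "qf_definable V M n P" "qf_definable V M n Q"
  shows "qf_definable V M n (\<lambda>as. P as \<and> Q as)"
proof -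
  obtain p q where "qf_in V p" "qf_vars p \<subseteq> {..<n}" "\<forall>as\<in>tuples M n. qf_sat M ((!) as) p \<longleftrightarrow> P as"
    "qf_in V q" "qf_vars q \<subseteq> {..<n}" "\<forall>as\<in>tuples M n. qf_sat M ((!) as) q \<longleftrightarrow> Q as"
    using assms unfolding qf_definable_def by blast
  then show ?thesis
    unfolding qf_definable_def by (intro exI[of _ "And p q"]) auto
qed

lemma qf_definable_disj:
  "qf_definable V M n P \<Longrightarrow> qf_definable V M n Q \<Longrightarrow> qf_definable V M n (\<lambda>as. P as \<or> Q as)"
  using qf_definable_not[OF qf_definable_conj[OF qf_definable_not qf_definable_not]] by fastforce

lemma qf_definable_iff:
  "qf_definable V M n P \<Longrightarrow> qf_definable V M n Q \<Longrightarrow> qf_definable V M n (\<lambda>as. P as \<longleftrightarrow> Q as)"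
  unfolding iff_conv_conj_imp imp_conv_disj
  by (intro qf_definable_conj qf_definable_disj qf_definable_not)

lemma qf_definable_Ball:
  assumes "finite I" "\<And>i. i \<in> I \<Longrightarrow> qf_definable V M n (P i)"
  shows "qf_definable V M n (\<lambda>as. \<forall>i\<in>I. P i as)"
  using assms
proof (induction I rule: finite_induct)
  case empty
  show ?case using qf_definable_const[of V M n True] by simp
next
  case (insert i I)
  then show ?case using qf_definable_conj[of V M n "P i" "\<lambda>as. \<forall>i\<in>I. P i as"] by simp
qed

lemma qf_definable_Bex:
  assumes "finite I" "\<And>i. i \<in> I \<Longrightarrow> qf_definable V M n (P i)"
  shows "qf_definable V M n (\<lambda>as. \<exists>i\<in>I. P i as)"
  using qf_definable_not[OF qf_definable_Ball[OF assms(1) qf_definable_not[OF assms(2)]]] by simp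

lemma qf_definable_map_upt:
  assumes "\<And>i. i < N \<Longrightarrow> qf_definable V M n (P i)"
  shows "qf_definable V M n (\<lambda>as. D (map (\<lambda>i. P i as) [0..<N]))"
proof -
  let ?I = "{d :: bool list. length d = N \<and> D d}"
  have "finite ?I"
    by (rule finite_subset[OF _ finite_lists_length_eq[of "UNIV :: bool set" N]]) auto
  then have "qf_definable V M n (\<lambda>as. \<exists>d\<in>?I. \<forall>i\<in>{..<N}. P i as \<longleftrightarrow> d ! i)"
    using assms
    by (intro qf_definable_Bex qf_definable_Ball qf_definable_iff qf_definable_const) auto
  moreover have "(\<forall>i\<in>{..<N}. P i as \<longleftrightarrow> d ! i) \<longleftrightarrow> d = map (\<lambda>i. P i as) [0..<N]" if "d \<in> ?I" for as d
    using that by (auto simp: list_eq_iff_nth_eq)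
  then have "(\<exists>d\<in>?I. \<forall>i\<in>{..<N}. P i as \<longleftrightarrow> d ! i) \<longleftrightarrow> D (map (\<lambda>i. P i as) [0..<N])" for as
    by auto
  ultimately show ?thesis by simp
qed

lemma qf_definable_qf_sat:
  assumes "qf_in V p" "\<rho> ` qf_vars p \<subseteq> {..<n}"
  shows "qf_definable V M n (\<lambda>as. qf_sat M (\<lambda>i. as ! \<rho> i) p)"
  unfolding qf_definable_def using assms
  by (intro exI[of _ "qf_rename \<rho> p"]) (simp add: qf_in_rename qf_vars_rename qf_sat_rename)

lemma qf_definable_atom_sat:
  assumes "atom_in V a" "\<rho> ` atom_vars a \<subseteq> {..<n}"
  shows "qf_definable V M n (\<lambda>as. atom_sat M (\<lambda>i. as ! \<rho> i) a)"
  using qf_definable_qf_sat[of V "Atom a" \<rho> n M] assms by simp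

section \<open>Countable ordinals and tuples\<close>

lemma omega1_zero_le [simp]: "(0::omega1) \<le> \<alpha>"
  unfolding zero_omega1_def by (rule Least_le) simp

lemma omega1_pos_iff: "0 < (\<alpha>::omega1) \<longleftrightarrow> \<alpha> \<noteq> 0"
  by (simp add: less_le)

lemma omega1_zero_less_one: "(0::omega1) < 1"
proof -
  have "infinite (Field (cardSuc natLeq))"
    using cardSuc_finite[OF natLeq_Card_order] by (simp add: Field_natLeq)
  then have "infinite (UNIV :: omega1 set)"
    using type_definition.Rep_range[OF type_definition_omega1] by (metis finite_imageI)
  then obtain \<beta> :: omega1 where "\<beta> \<noteq> 0"
    by (metis UNIV_eq_I finite.emptyI finite.insertI singletonI)
  then have "(0::omega1) < \<beta>" by (simp add: omega1_pos_iff)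
  then show ?thesis unfolding one_omega1_def by (rule LeastI)
qed

lemma tuples_append: "as \<in> tuples M m \<Longrightarrow> bs \<in> tuples M n \<Longrightarrow> as @ bs \<in> tuples M (m + n)"
  by (auto simp: tuples_def)

lemma Bex_tuples_add:
  "(\<exists>ds\<in>tuples M (m + n). P ds) \<longleftrightarrow> (\<exists>bs\<in>tuples M m. \<exists>cs\<in>tuples M n. P (bs @ cs))"
proof
  assume "\<exists>ds\<in>tuples M (m + n). P ds"
  then obtain ds where ds: "ds \<in> tuples M (m + n)" "P ds" by blast
  then have "take m ds \<in> tuples M m" "drop m ds \<in> tuples M n"
    by (auto simp: tuples_def dest: in_set_takeD in_set_dropD)
  then show "\<exists>bs\<in>tuples M m. \<exists>cs\<in>tuples M n. P (bs @ cs)"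
    using ds(2) by (metis append_take_drop_id)
qed (blast intro: tuples_append)

lemma take_in_tuples: "as \<in> tuples M m \<Longrightarrow> n \<le> m \<Longrightarrow> take n as \<in> tuples M n"
  by (auto simp: tuples_def dest: in_set_takeD)

lemma map_nth_in_tuples:
  "as \<in> tuples M m \<Longrightarrow> set ps \<subseteq> {..<m} \<Longrightarrow> map ((!) as) ps \<in> tuples M (length ps)"
  unfolding tuples_def by (auto simp: in_lists_conv_set subset_iff)

lemma nth_image_subset:
  assumes "I \<subseteq> {..<length xs}" "set xs \<subseteq> S"
  shows "(!) xs ` I \<subseteq> S"
proof (rule image_subsetI)
  fix i assume "i \<in> I"
  then have "xs ! i \<in> set xs" using assms(1) by (intro nth_mem) auto
  then show "xs ! i \<in> S" using assms(2) by blast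
qed

lemma tuples_Suc_0_iff: "as \<in> tuples M (Suc 0) \<longleftrightarrow> (\<exists>a\<in>univ M. as = [a])"
  by (auto simp: tuples_def length_Suc_conv)

lemma Bex_tuples_Suc_0: "(\<exists>as\<in>tuples M (Suc 0). P as) \<longleftrightarrow> (\<exists>a\<in>univ M. P [a])"
  by (auto simp: tuples_Suc_0_iff)

lemma nth_in_univ: "as \<in> tuples M n \<Longrightarrow> i < n \<Longrightarrow> as ! i \<in> univ M"
  by (auto simp: tuples_def in_lists_conv_set)

section \<open>The infinitary hierarchy of relations\<close>

definition ext_outside ::
  "('a, 'f, 'r) model \<Rightarrow> nat \<Rightarrow> 'i set \<Rightarrow> ('i \<Rightarrow> nat) \<Rightarrow> ('i \<Rightarrow> 'a list set) \<Rightarrow> 'a list set"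
  where "ext_outside M n I k R = {as \<in> tuples M n. \<exists>i\<in>I. \<exists>bs\<in>tuples M (k i). as @ bs \<notin> R i}"

text \<open>A name-free form of \<open>\<Sigma>\<close>-definability: \<open>\<Pi>\<close>-relations enter as complements, so that a single
  induction treats both sides of the hierarchy.\<close>

inductive Sigma_rel ::
  "('f, 'r) vocabulary \<Rightarrow> ('a, 'f, 'r) model \<Rightarrow> omega1 \<Rightarrow> nat \<Rightarrow> 'a list set \<Rightarrow> bool"
  for V M
where
  Sigma_rel_0: "qf_definable V M n P \<Longrightarrow> Sigma_rel V M 0 n {as \<in> tuples M n. P as}"
| Sigma_rel_step: "0 < \<alpha> \<Longrightarrow> (\<And>i::nat. \<exists>\<beta><\<alpha>. Sigma_rel V M \<beta> (n + k i) (R i)) \<Longrightarrow>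
    Sigma_rel V M \<alpha> n (ext_outside M n UNIV k R)"

lemma Sigma_rel_subset: "Sigma_rel V M \<alpha> n S \<Longrightarrow> S \<subseteq> tuples M n"
  by (induction rule: Sigma_rel.induct) (auto simp: ext_outside_def)

lemma Sigma_rel_zero_iff:
  "Sigma_rel V M 0 n S \<longleftrightarrow> S \<subseteq> tuples M n \<and> qf_definable V M n (\<lambda>as. as \<in> S)"
proof
  assume S: "Sigma_rel V M 0 n S"
  then have "qf_definable V M n (\<lambda>as. as \<in> S)"
    by cases (auto intro: qf_definable_cong)
  then show "S \<subseteq> tuples M n \<and> qf_definable V M n (\<lambda>as. as \<in> S)"
    using Sigma_rel_subset[OF S] by simp
next
  assume S: "S \<subseteq> tuples M n \<and> qf_definable V M n (\<lambda>as. as \<in> S)"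
  then have "{as \<in> tuples M n. as \<in> S} = S" by blast
  then show "Sigma_rel V M 0 n S" using Sigma_rel_0[of V M n "\<lambda>as. as \<in> S"] S by simp
qed

lemma Sigma_rel_posE:
  assumes "Sigma_rel V M \<alpha> n S" "0 < \<alpha>"
  obtains k R where "\<forall>i::nat. \<exists>\<beta><\<alpha>. Sigma_rel V M \<beta> (n + k i) (R i)" "S = ext_outside M n UNIV k R"
  using assms by cases auto

lemma Sigma_rel_Compl:
  assumes "Sigma_rel V M \<beta> n S" "\<beta> < \<alpha>"
  shows "Sigma_rel V M \<alpha> n (tuples M n - S)"
proof -
  have "\<exists>\<beta><\<alpha>. Sigma_rel V M \<beta> (n + 0) S" using assms by auto
  then have "Sigma_rel V M \<alpha> n (ext_outside M n (UNIV :: nat set) (\<lambda>_. 0) (\<lambda>_. S))"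
    using assms(2) by (intro Sigma_rel_step) (auto intro: le_less_trans)
  moreover have "ext_outside M n (UNIV :: nat set) (\<lambda>_. 0) (\<lambda>_. S) = tuples M n - S"
    by (auto simp: ext_outside_def tuples_def)
  ultimately show ?thesis by simp
qed

lemma Sigma_rel_zero_Compl: "Sigma_rel V M 0 n S \<Longrightarrow> Sigma_rel V M 0 n (tuples M n - S)"
  by (auto simp: Sigma_rel_zero_iff set_diff_eq intro!: qf_definable_conj qf_definable_not
      intro: qf_definable_cong[OF qf_definable_const[of _ _ _ True]])

lemma Sigma_rel_mono:
  assumes "Sigma_rel V M \<alpha> n S" "\<alpha> \<le> \<beta>"
  shows "Sigma_rel V M \<beta> n S"
proof (cases "\<alpha> = 0")
  case True
  show ?thesis
  proof (cases "\<beta> = 0")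
    case False
    then have "Sigma_rel V M \<beta> n (tuples M n - (tuples M n - S))"
      using assms(1) True
      by (intro Sigma_rel_Compl[OF Sigma_rel_zero_Compl]) (simp_all add: omega1_pos_iff)
    then show ?thesis using Sigma_rel_subset[OF assms(1)] by (simp add: double_diff)
  qed (use assms True in simp)
next
  case False
  then have pos: "0 < \<alpha>" by (simp add: omega1_pos_iff)
  obtain k R where "\<forall>i::nat. \<exists>\<beta><\<alpha>. Sigma_rel V M \<beta> (n + k i) (R i)" "S = ext_outside M n UNIV k R"
    by (rule Sigma_rel_posE[OF assms(1) pos])
  then show ?thesis
    using assms(2) pos by (auto intro!: Sigma_rel_step intro: less_le_trans)
qed

lemma Sigma_rel_countable:
  assumes "0 < \<alpha>" "countable I" "\<And>i. i \<in> I \<Longrightarrow> \<exists>\<beta><\<alpha>. Sigma_rel V M \<beta> (n + k i) (R i)"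
  shows "Sigma_rel V M \<alpha> n (ext_outside M n I k R)"
proof (cases "I = {}")
  case True
  have "Sigma_rel V M 0 n (tuples M n)"
    using Sigma_rel_0[OF qf_definable_const[of V M n True]] by simp
  then have "Sigma_rel V M \<alpha> n {}" using Sigma_rel_Compl assms(1) by fastforce
  then show ?thesis using True by (simp add: ext_outside_def)
next
  case False
  let ?f = "from_nat_into I"
  have "Sigma_rel V M \<alpha> n (ext_outside M n UNIV (k \<circ> ?f) (R \<circ> ?f))"
    using assms(1) assms(3)[OF from_nat_into[OF False]] by (intro Sigma_rel_step) auto
  moreover have "ext_outside M n UNIV (k \<circ> ?f) (R \<circ> ?f) = ext_outside M n (range ?f) k R"
    by (auto simp: ext_outside_def)
  ultimately show ?thesis using False assms(2) by (simp add: range_from_nat_into)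
qed

definition covers_extensions ::
  "('a, 'f, 'r) model \<Rightarrow> ('b, 'g, 's) model \<Rightarrow> nat \<Rightarrow> nat \<Rightarrow> ('a list \<Rightarrow> 'b list) \<Rightarrow>
    (nat \<times> ('a list \<Rightarrow> 'b list)) set \<Rightarrow> bool"
  where "covers_extensions M N m k f I \<longleftrightarrow> (\<forall>as\<in>tuples M m.
    (@) (f as) ` tuples N k = (\<Union>(l, g)\<in>I. (\<lambda>bs. g (as @ bs)) ` tuples M l))"

text \<open>Along such maps a quantifier over \<open>N\<close> turns into a countable disjunction of quantifiers over
  \<open>M\<close>, so relations pull back to the same level of the hierarchy.\<close>

locale tuple_coding =
  fixes V :: "('f, 'r) vocabulary" and M :: "('a, 'f, 'r) model"
    and W :: "('g, 's) vocabulary" and N :: "('b, 'g, 's) model"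
    and \<C> :: "nat \<Rightarrow> nat \<Rightarrow> ('a list \<Rightarrow> 'b list) set"
  assumes code_in_tuples: "f \<in> \<C> m n \<Longrightarrow> as \<in> tuples M m \<Longrightarrow> f as \<in> tuples N n"
    and qf_definable_code_atom: "f \<in> \<C> m n \<Longrightarrow> atom_in W a \<Longrightarrow> atom_vars a \<subseteq> {..<n} \<Longrightarrow>
      qf_definable V M m (\<lambda>as. atom_sat N ((!) (f as)) a)"
    and code_extension: "f \<in> \<C> m n \<Longrightarrow>
      \<exists>I. countable I \<and> (\<forall>(l, g)\<in>I. g \<in> \<C> (m + l) (n + k)) \<and> covers_extensions M N m k f I"
begin

lemma qf_definable_pullback:
  assumes f: "f \<in> \<C> m n" and "qf_definable W N n P"
  shows "qf_definable V M m (\<lambda>as. P (f as))"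
proof -
  obtain p where p: "qf_in W p" "qf_vars p \<subseteq> {..<n}"
    and P: "\<forall>bs\<in>tuples N n. qf_sat N ((!) bs) p \<longleftrightarrow> P bs"
    by (rule qf_definableE[OF assms(2)])
  have "qf_definable V M m (\<lambda>as. qf_sat N ((!) (f as)) p)"
    using p
    by (induction p) (auto intro: qf_definable_const qf_definable_not qf_definable_conj
        qf_definable_disj qf_definable_code_atom[OF f])
  then show ?thesis
    by (rule qf_definable_cong) (use P code_in_tuples[OF f] in blast)
qed

lemma ext_outside_pullback:
  assumes f: "f \<in> \<C> m n"
    and covers: "\<And>i. i \<in> J \<Longrightarrow> covers_extensions M N m (k i) f (I i)"
  shows "{as \<in> tuples M m. f as \<in> ext_outside N n J k R} =
    ext_outside M m (SIGMA i:J. I i) (\<lambda>(i, l, g). l)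
      (\<lambda>(i, l, g). {as \<in> tuples M (m + l). g as \<in> R i})"
    (is "_ = ?S")
proof -
  have "as \<in> ?S \<longleftrightarrow> f as \<in> ext_outside N n J k R" if as: "as \<in> tuples M m" for as
  proof -
    have "as \<in> ?S \<longleftrightarrow> (\<exists>i\<in>J. \<exists>(l, g)\<in>I i. \<exists>bs\<in>tuples M l. g (as @ bs) \<notin> R i)"
      using as by (simp add: ext_outside_def split_def tuples_append[OF as] cong: bex_cong)
    also have "\<dots> \<longleftrightarrow> (\<exists>i\<in>J. \<exists>ys\<in>(\<Union>(l, g)\<in>I i. (\<lambda>bs. g (as @ bs)) ` tuples M l). ys \<notin> R i)"
      by blast
    also have "\<dots> \<longleftrightarrow> (\<exists>i\<in>J. \<exists>ys\<in>(@) (f as) ` tuples N (k i). ys \<notin> R i)"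
      using covers as by (simp add: covers_extensions_def cong: bex_cong)
    finally show ?thesis using code_in_tuples[OF f as] by (simp add: ext_outside_def)
  qed
  then show ?thesis unfolding ext_outside_def by blast
qed

lemma Sigma_rel_pullback:
  assumes "Sigma_rel W N \<alpha> n S" "f \<in> \<C> m n"
  shows "Sigma_rel V M \<alpha> m {as \<in> tuples M m. f as \<in> S}"
  using assms
proof (induction arbitrary: f m rule: Sigma_rel.induct)
  case (Sigma_rel_0 n P)
  have "{as \<in> tuples M m. f as \<in> {bs \<in> tuples N n. P bs}} = {as \<in> tuples M m. P (f as)}"
    using code_in_tuples[OF Sigma_rel_0.prems] by blast
  then show ?case
    using Sigma_rel.Sigma_rel_0[OF qf_definable_pullback[OF Sigma_rel_0.prems Sigma_rel_0.hyps]] by simp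
next
  case (Sigma_rel_step \<alpha> n k R)
  have "\<forall>i. \<exists>I. countable I \<and> (\<forall>(l, g)\<in>I. g \<in> \<C> (m + l) (n + k i)) \<and>
      covers_extensions M N m (k i) f I"
    using code_extension[OF Sigma_rel_step.prems] by blast
  from choice[OF this] obtain I where "\<forall>i. countable (I i) \<and>
      (\<forall>(l, g)\<in>I i. g \<in> \<C> (m + l) (n + k i)) \<and> covers_extensions M N m (k i) f (I i)" ..
  then have I: "countable (I i)" "\<forall>(l, g)\<in>I i. g \<in> \<C> (m + l) (n + k i)"
    and covers: "covers_extensions M N m (k i) f (I i)" for i
    by simp_all
  show ?case
    unfolding ext_outside_pullback[OF Sigma_rel_step.prems covers]
  proof (rule Sigma_rel_countable[OF \<open>0 < \<alpha>\<close>])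
    show "countable (SIGMA i:UNIV. I i)" using I(1) by (intro countable_SIGMA) auto
    fix x assume "x \<in> (SIGMA i:UNIV. I i)"
    then obtain i l g where x: "x = (i, l, g)" "(l, g) \<in> I i" by auto
    then have "g \<in> \<C> (m + l) (n + k i)" using I(2)[of i] by blast
    then show "\<exists>\<beta><\<alpha>. Sigma_rel V M \<beta> (m + (case x of (i, l, g) \<Rightarrow> l))
        (case x of (i, l, g) \<Rightarrow> {as \<in> tuples M (m + l). g as \<in> R i})"
      using Sigma_rel_step.IH[of i] x(1) by auto
  qed
qed

end

lemma tuple_coding_reindex:
  fixes M :: "('a, 'f, 'r) model"
  shows "tuple_coding V M V M (\<lambda>m n. {\<lambda>as. map ((!) as) ps |ps. length ps = n \<and> set ps \<subseteq> {..<m}})"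
    (is "tuple_coding _ _ _ _ ?\<C>")
proof
  fix f :: "'a list \<Rightarrow> 'a list" and m n k :: nat
  assume "f \<in> ?\<C> m n"
  then obtain ps where f: "f = (\<lambda>as. map ((!) as) ps)" and ps: "length ps = n" "set ps \<subseteq> {..<m}"
    by blast
  show "f as \<in> tuples M n" if "as \<in> tuples M m" for as
    using map_nth_in_tuples[OF that ps(2)] f ps(1) by simp
  show "qf_definable V M m (\<lambda>as. atom_sat M ((!) (f as)) a)"
    if a: "atom_in V a" "atom_vars a \<subseteq> {..<n}" for a
  proof -
    have "atom_sat M (\<lambda>i. as ! (ps ! i)) a = atom_sat M ((!) (f as)) a" for as
      using a(2) ps(1) by (intro atom_sat_cong) (auto simp: f)
    moreover have "(!) ps ` atom_vars a \<subseteq> {..<m}" using a(2) ps by (intro nth_image_subset) simp_all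
    ultimately show ?thesis using qf_definable_atom_sat[OF a(1), of "(!) ps" m M] by simp
  qed
  let ?g = "\<lambda>as. map ((!) as) (ps @ [m..<m + k])"
  have "?g (as @ bs) = f as @ bs" if "as \<in> tuples M m" "bs \<in> tuples M k" for as bs
    using that ps by (intro nth_equalityI) (auto simp: f tuples_def nth_append subset_iff)
  then have "(@) (f as) ` tuples M k = (\<lambda>bs. ?g (as @ bs)) ` tuples M k" if "as \<in> tuples M m" for as
    using that by (intro image_cong) auto
  then have "covers_extensions M M m k f {(k, ?g)}" by (simp add: covers_extensions_def)
  moreover have "?g \<in> ?\<C> (m + k) (n + k)"
    using ps by (intro CollectI exI[of _ "ps @ [m..<m + k]"]) auto
  ultimately show "\<exists>I. countable I \<and> (\<forall>(l, g)\<in>I. g \<in> ?\<C> (m + l) (n + k)) \<and> covers_extensions M M m k f I"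
    by (intro exI[of _ "{(k, ?g)}"]) simp
qed

lemma Sigma_rel_reindex:
  assumes "Sigma_rel V M \<alpha> n S" "length ps = n" "set ps \<subseteq> {..<m}"
  shows "Sigma_rel V M \<alpha> m {as \<in> tuples M m. map ((!) as) ps \<in> S}"
  by (rule tuple_coding.Sigma_rel_pullback[OF tuple_coding_reindex assms(1)])
    (use assms(2,3) in blast)

lemma Sigma_rel_take:
  assumes "Sigma_rel V M \<alpha> n S"
  shows "Sigma_rel V M \<alpha> (n + k) {as \<in> tuples M (n + k). take n as \<in> S}"
proof -
  have "map ((!) as) [0..<n] = take n as" if "as \<in> tuples M (n + k)" for as
    using that by (auto simp: tuples_def intro: nth_equalityI)
  then have "{as \<in> tuples M (n + k). map ((!) as) [0..<n] \<in> S} =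
      {as \<in> tuples M (n + k). take n as \<in> S}"
    by auto
  then show ?thesis
    using Sigma_rel_reindex[OF assms, of "[0..<n]" "n + k"] by (simp add: atLeast0LessThan)
qed

lemma Sigma_rel_Ex:
  assumes "0 < \<alpha>" "countable I" "\<And>i. i \<in> I \<Longrightarrow> Sigma_rel V M \<alpha> (n + k i) (S i)"
  shows "Sigma_rel V M \<alpha> n {as \<in> tuples M n. \<exists>i\<in>I. \<exists>bs\<in>tuples M (k i). as @ bs \<in> S i}"
proof -
  have "\<forall>i\<in>I. \<exists>l R. (\<forall>j::nat. \<exists>\<beta><\<alpha>. Sigma_rel V M \<beta> (n + k i + l j) (R j)) \<and>
      S i = ext_outside M (n + k i) UNIV l R"
    by (intro ballI, erule Sigma_rel_posE[OF assms(3) assms(1)]) blast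
  then obtain l R where R: "\<And>i j::nat. i \<in> I \<Longrightarrow> \<exists>\<beta><\<alpha>. Sigma_rel V M \<beta> (n + k i + l i j) (R i j)"
    and S: "\<And>i. i \<in> I \<Longrightarrow> S i = ext_outside M (n + k i) UNIV (l i) (R i)"
    by metis
  have "Sigma_rel V M \<alpha> n (ext_outside M n (I \<times> UNIV) (\<lambda>(i, j). k i + l i j) (\<lambda>(i, j). R i j))"
    using assms(1,2) R by (intro Sigma_rel_countable) (auto simp: add.assoc)
  moreover have "(\<exists>bs\<in>tuples M (k i). as @ bs \<in> S i) \<longleftrightarrow>
      (\<exists>j. \<exists>ds\<in>tuples M (k i + l i j). as @ ds \<notin> R i j)"
    if "i \<in> I" "as \<in> tuples M n" for i as
    unfolding Bex_tuples_add S[OF that(1)] ext_outside_def using tuples_append[OF that(2)] by auto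
  then have "ext_outside M n (I \<times> UNIV) (\<lambda>(i, j). k i + l i j) (\<lambda>(i, j). R i j) =
      {as \<in> tuples M n. \<exists>i\<in>I. \<exists>bs\<in>tuples M (k i). as @ bs \<in> S i}"
    by (simp add: ext_outside_def cong: conj_cong bex_cong)
  ultimately show ?thesis by simp
qed

lemma Sigma_rel_Un:
  assumes "Sigma_rel V M \<alpha> n S" "Sigma_rel V M \<alpha> n S'"
  shows "Sigma_rel V M \<alpha> n (S \<union> S')"
proof (cases "\<alpha> = 0")
  case True
  then show ?thesis using assms by (auto simp: Sigma_rel_zero_iff intro: qf_definable_disj)
next
  case False
  then have "Sigma_rel V M \<alpha> n
      {as \<in> tuples M n. \<exists>b\<in>UNIV. \<exists>bs\<in>tuples M 0. as @ bs \<in> (if b then S else S')}"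
    using assms by (intro Sigma_rel_Ex) (auto simp: omega1_pos_iff)
  moreover have
    "{as \<in> tuples M n. \<exists>b\<in>UNIV. \<exists>bs\<in>tuples M 0. as @ bs \<in> (if b then S else S')} = S \<union> S'"
    using assms[THEN Sigma_rel_subset] by (auto simp: tuples_def split: if_splits)
  ultimately show ?thesis by simp
qed

lemma Sigma_rel_Diff:
  assumes "Sigma_rel V M \<alpha> n S" "Sigma_rel V M \<beta> n R" "\<beta> < \<alpha>"
  shows "Sigma_rel V M \<alpha> n (S - R)"
proof -
  have pos: "0 < \<alpha>" using assms(3) omega1_zero_le by (rule le_less_trans[rotated])
  obtain k Q where Q: "\<forall>i::nat. \<exists>\<gamma><\<alpha>. Sigma_rel V M \<gamma> (n + k i) (Q i)"
    and S: "S = ext_outside M n UNIV k Q"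
    by (rule Sigma_rel_posE[OF assms(1) pos])
  let ?R = "\<lambda>i. {cs \<in> tuples M (n + k i). take n cs \<in> R}"
  have "Sigma_rel V M \<alpha> n (ext_outside M n UNIV k (\<lambda>i. Q i \<union> ?R i))"
  proof (rule Sigma_rel_step[OF pos])
    fix i
    obtain \<gamma> where \<gamma>: "\<gamma> < \<alpha>" "Sigma_rel V M \<gamma> (n + k i) (Q i)" using Q by blast
    have "Sigma_rel V M (max \<beta> \<gamma>) (n + k i) (Q i \<union> ?R i)"
      by (intro Sigma_rel_Un Sigma_rel_mono[OF \<gamma>(2)] Sigma_rel_mono[OF Sigma_rel_take[OF assms(2)]])
        simp_all
    then show "\<exists>\<gamma><\<alpha>. Sigma_rel V M \<gamma> (n + k i) (Q i \<union> ?R i)"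
      using \<gamma>(1) assms(3) by (intro exI[of _ "max \<beta> \<gamma>"]) simp
  qed
  moreover have "as @ bs \<in> ?R i \<longleftrightarrow> as \<in> R" if "as \<in> tuples M n" "bs \<in> tuples M (k i)" for as bs i
    using tuples_append[OF that] that(1) by (simp add: tuples_def)
  then have "ext_outside M n UNIV k (\<lambda>i. Q i \<union> ?R i) = S - R"
    unfolding S ext_outside_def by blast
  ultimately show ?thesis by simp
qed

lemma Sigma_rel_Int:
  assumes "Sigma_rel V M \<alpha> n S" "Sigma_rel V M \<alpha> n S'"
  shows "Sigma_rel V M \<alpha> n (S \<inter> S')"
proof (cases "\<alpha> = 0")
  case True
  then show ?thesis using assms by (auto simp: Sigma_rel_zero_iff intro: qf_definable_conj)
next
  case False
  then have pos: "0 < \<alpha>" by (simp add: omega1_pos_iff)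
  obtain k R where R: "\<forall>i::nat. \<exists>\<beta><\<alpha>. Sigma_rel V M \<beta> (n + k i) (R i)"
    and S: "S = ext_outside M n UNIV k R"
    by (rule Sigma_rel_posE[OF assms(1) pos])
  let ?S' = "\<lambda>i. {cs \<in> tuples M (n + k i). take n cs \<in> S'}"
  have "Sigma_rel V M \<alpha> (n + k i) (?S' i - R i)" for i
    using R Sigma_rel_Diff[OF Sigma_rel_take[OF assms(2)]] by blast
  then have "Sigma_rel V M \<alpha> n {as \<in> tuples M n. \<exists>i\<in>UNIV. \<exists>bs\<in>tuples M (k i). as @ bs \<in> ?S' i - R i}"
    by (intro Sigma_rel_Ex[OF pos]) auto
  moreover have "as @ bs \<in> ?S' i \<longleftrightarrow> as \<in> S'" if "as \<in> tuples M n" "bs \<in> tuples M (k i)" for as bs i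
    using tuples_append[OF that] that(1) by (simp add: tuples_def)
  then have "{as \<in> tuples M n. \<exists>i\<in>UNIV. \<exists>bs\<in>tuples M (k i). as @ bs \<in> ?S' i - R i} = S \<inter> S'"
    unfolding S ext_outside_def by blast
  ultimately show ?thesis by simp
qed

lemma Sigma_rel_Ball:
  assumes "finite I" "\<And>i. i \<in> I \<Longrightarrow> Sigma_rel V M \<alpha> n (S i)"
  shows "Sigma_rel V M \<alpha> n {as \<in> tuples M n. \<forall>i\<in>I. as \<in> S i}"
  using assms
proof (induction I rule: finite_induct)
  case empty
  show ?case
    using Sigma_rel_mono[OF Sigma_rel_0[OF qf_definable_const[of V M n True]] omega1_zero_le] by simp
next
  case (insert i I)
  then have "Sigma_rel V M \<alpha> n (S i \<inter> {as \<in> tuples M n. \<forall>i\<in>I. as \<in> S i})"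
    by (intro Sigma_rel_Int) auto
  moreover have "S i \<inter> {as \<in> tuples M n. \<forall>i\<in>I. as \<in> S i} = {as \<in> tuples M n. \<forall>j\<in>insert i I. as \<in> S j}"
    using Sigma_rel_subset insert.prems by blast
  ultimately show ?case by simp
qed

section \<open>Formulas define exactly the relations of the hierarchy\<close>

text \<open>The variables \<open>xs\<close> bound by a quantifier block are sent to the positions from \<open>n\<close> onwards, those
  of the witnesses appended to an \<open>n\<close>-tuple.\<close>

definition extend_renaming :: "(nat \<Rightarrow> nat) \<Rightarrow> nat \<Rightarrow> nat list \<Rightarrow> nat \<Rightarrow> nat"
  where "extend_renaming \<rho> n xs i =
    (case map_of (zip xs [n..<n + length xs]) i of None \<Rightarrow> \<rho> i | Some j \<Rightarrow> j)"

lemma extend_renaming_free: "i \<notin> set xs \<Longrightarrow> extend_renaming \<rho> n xs i = \<rho> i"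
  by (simp add: extend_renaming_def map_of_zip_is_None[THEN iffD2])

lemma extend_renaming_bound:
  assumes "i \<in> set xs"
  obtains j where "extend_renaming \<rho> n xs i = n + j" "j < length xs" "xs ! j = i"
proof -
  obtain p where p: "map_of (zip xs [n..<n + length xs]) i = Some p"
    using assms map_of_zip_is_Some[of xs "[n..<n + length xs]" i] by auto
  then have "(i, p) \<in> set (zip xs [n..<n + length xs])" by (rule map_of_SomeD)
  then show ?thesis using that p by (auto simp: in_set_zip extend_renaming_def)
qed

lemma extend_renaming_image:
  assumes "\<rho> ` (B - set xs) \<subseteq> {..<n}"
  shows "extend_renaming \<rho> n xs ` B \<subseteq> {..<n + length xs}"
proof (rule image_subsetI)
  fix i assume i: "i \<in> B"
  show "extend_renaming \<rho> n xs i \<in> {..<n + length xs}"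
  proof (cases "i \<in> set xs")
    case True
    then show ?thesis by (rule extend_renaming_bound[of i xs \<rho> n]) simp
  next
    case False
    then have "\<rho> i < n" using assms i by auto
    then show ?thesis using False by (simp add: extend_renaming_free)
  qed
qed

lemma nth_extend_renaming_bound:
  assumes "length as = n" "i \<in> set xs"
  obtains j where "j < length xs" "xs ! j = i" "(as @ bs) ! extend_renaming \<rho> n xs i = bs ! j"
  using assms(2)
  by (rule extend_renaming_bound[of i xs \<rho> n]) (use that assms(1) in \<open>simp add: nth_append\<close>)

lemma nth_extend_renaming_free:
  assumes "length as = n" "i \<notin> set xs" "\<rho> i < n"
  shows "(as @ bs) ! extend_renaming \<rho> n xs i = as ! \<rho> i"
  using assms by (simp add: extend_renaming_free nth_append)

lemma Bex_reassign_iff_Bex_tuples: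
  assumes Q: "\<And>v w. (\<And>i. i \<in> B \<Longrightarrow> v i = w i) \<Longrightarrow> Q v = Q w"
    and as: "as \<in> tuples M n" and \<rho>: "\<rho> ` (B - set xs) \<subseteq> {..<n}"
  shows "(\<exists>w\<in>reassign M xs (\<lambda>i. as ! \<rho> i). Q w) \<longleftrightarrow>
    (\<exists>bs\<in>tuples M (length xs). Q (\<lambda>i. (as @ bs) ! extend_renaming \<rho> n xs i))"
    (is "?L \<longleftrightarrow> ?R")
proof -
  let ?v = "\<lambda>bs i. (as @ bs) ! extend_renaming \<rho> n xs i"
  have len: "length as = n" using as by (simp add: tuples_def)
  have free: "?v bs i = as ! \<rho> i" if "i \<in> B" "i \<notin> set xs" for i bs
    using that \<rho> by (intro nth_extend_renaming_free[OF len]) auto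
  show ?thesis
  proof
    assume ?L
    then obtain w where w: "w \<in> reassign M xs (\<lambda>i. as ! \<rho> i)" "Q w" by blast
    then have reassigned: "if i \<in> set xs then w i \<in> univ M else w i = as ! \<rho> i" for i
      by (simp add: reassign_def)
    have "?v (map w xs) i = w i" if "i \<in> B" for i
    proof (cases "i \<in> set xs")
      case True
      then show ?thesis
        by (rule nth_extend_renaming_bound[OF len, where bs = "map w xs" and \<rho> = \<rho>]) auto
    next
      case False
      then show ?thesis using free[OF that] reassigned[of i] by simp
    qed
    then have "Q (?v (map w xs)) = Q w" by (rule Q)
    moreover have "w x \<in> univ M" if "x \<in> set xs" for x using reassigned[of x] that by simp
    then have "map w xs \<in> tuples M (length xs)" by (auto simp: tuples_def)
    ultimately show ?R using w(2) by blast
  next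
    assume ?R
    then obtain bs where bs: "bs \<in> tuples M (length xs)" "Q (?v bs)" by blast
    let ?w = "\<lambda>i. if i \<in> set xs then ?v bs i else as ! \<rho> i"
    have "?v bs i \<in> univ M" if "i \<in> set xs" for i
      by (rule nth_extend_renaming_bound[OF len that, where bs = bs and \<rho> = \<rho>])
        (use nth_in_univ[OF bs(1)] in auto)
    then have "?w \<in> reassign M xs (\<lambda>i. as ! \<rho> i)" by (simp add: reassign_def)
    moreover have "Q (?v bs) = Q ?w" by (rule Q) (use free in auto)
    ultimately show ?L using bs(2) by blast
  qed
qed

lemma Sigma_in_imp_Sigma_rel:
  assumes "Sigma_in \<alpha> \<phi>" "fm_in V \<phi>" "\<rho> ` fm_vars \<phi> \<subseteq> {..<n}"
  shows "Sigma_rel V M \<alpha> n {as \<in> tuples M n. fm_sat M (\<lambda>i. as ! \<rho> i) \<phi>}"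
  using assms
proof (induction \<alpha> arbitrary: \<phi> \<rho> n rule: less_induct)
  case (less \<alpha>)
  from less.prems(1) show ?case
  proof cases
    case (Sigma_0 p)
    then show ?thesis using less.prems by (auto intro!: Sigma_rel_0 qf_definable_qf_sat)
  next
    case (Sigma_step F X)
    let ?\<rho> = "\<lambda>m. extend_renaming \<rho> n (X m)" and ?k = "\<lambda>m. length (X m)"
    let ?R = "\<lambda>m. {as \<in> tuples M (n + ?k m). fm_sat M (\<lambda>i. as ! ?\<rho> m i) (fm_dual (F m))}"
    have vars: "\<rho> ` (fm_vars (F m) - set (X m)) \<subseteq> {..<n}" for m
      using less.prems(3) Sigma_step(1) by auto
    have "\<exists>\<beta><\<alpha>. Sigma_rel V M \<beta> (n + ?k m) (?R m)" for m
    proof -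
      obtain \<beta> where \<beta>: "\<beta> < \<alpha>" "Sigma_in \<beta> (fm_dual (F m))"
        using Sigma_step(3) Sigma_in_dual by blast
      moreover have "fm_in V (fm_dual (F m))" using less.prems(2) Sigma_step(1) by simp
      ultimately have "Sigma_rel V M \<beta> (n + ?k m) (?R m)"
        using extend_renaming_image[OF vars] by (intro less.IH) simp_all
      then show ?thesis using \<beta>(1) by blast
    qed
    then have "Sigma_rel V M \<alpha> n (ext_outside M n UNIV ?k ?R)"
      by (rule Sigma_rel_step[OF Sigma_step(2)])
    moreover have "(\<exists>w\<in>reassign M (X m) (\<lambda>i. as ! \<rho> i). fm_sat M w (F m)) \<longleftrightarrow>
        (\<exists>bs\<in>tuples M (?k m). as @ bs \<notin> ?R m)" if as: "as \<in> tuples M n" for as m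
      using Bex_reassign_iff_Bex_tuples[where Q = "\<lambda>w. fm_sat M w (F m)", OF fm_sat_cong as vars]
      by (simp add: tuples_append[OF as] cong: bex_cong)
    then have "ext_outside M n UNIV ?k ?R = {as \<in> tuples M n. fm_sat M (\<lambda>i. as ! \<rho> i) \<phi>}"
      unfolding Sigma_step(1) ext_outside_def by (simp cong: conj_cong)
    ultimately show ?thesis by simp
  qed
qed

lemma Bex_reassign_upt:
  assumes Q: "\<And>v w. (\<And>i. i < n + k \<Longrightarrow> v i = w i) \<Longrightarrow> Q v = Q w"
    and as: "as \<in> tuples M n"
  shows "(\<exists>w\<in>reassign M [n..<n + k] ((!) as). Q w) \<longleftrightarrow> (\<exists>bs\<in>tuples M k. Q ((!) (as @ bs)))"
proof -
  have "extend_renaming (\<lambda>i. i) n [n..<n + k] i = i" if "i < n + k" for i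
  proof (cases "n \<le> i")
    case True
    then have "i \<in> set [n..<n + k]" using that by simp
    then show ?thesis by (rule extend_renaming_bound[of i "[n..<n + k]" "\<lambda>i. i" n]) simp
  qed (simp add: extend_renaming_free)
  then have "Q (\<lambda>i. (as @ bs) ! extend_renaming (\<lambda>i. i) n [n..<n + k] i) = Q ((!) (as @ bs))" for bs
    by (intro Q) simp
  moreover have Q_cong: "Q v = Q w" if "\<And>i. i \<in> {..<n + k} \<Longrightarrow> v i = w i" for v w
    using that by (intro Q) simp
  have "(\<lambda>i. i) ` ({..<n + k} - set [n..<n + k]) \<subseteq> {..<n}" by auto
  note Bex_reassign_iff_Bex_tuples[OF Q_cong as this]
  ultimately show ?thesis by simp
qed

lemma Sigma_rel_imp_Sigma_definable:
  assumes "Sigma_rel V M \<alpha> n S"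
  shows "Sigma_definable V M \<alpha> n S"
  using assms
proof (induction rule: Sigma_rel.induct)
  case (Sigma_rel_0 n P)
  then obtain p where "qf_in V p" "qf_vars p \<subseteq> {..<n}" "\<forall>as\<in>tuples M n. qf_sat M ((!) as) p \<longleftrightarrow> P as"
    by (rule qf_definableE)
  then show ?case
    unfolding Sigma_definable_def by (intro exI[of _ "QF p"]) (auto intro: Sigma_in_Pi_in.Sigma_0)
next
  case (Sigma_rel_step \<alpha> n k R)
  have "\<forall>i. \<exists>\<phi>. (\<exists>\<beta><\<alpha>. Sigma_in \<beta> \<phi>) \<and> fm_in V \<phi> \<and> fm_vars \<phi> \<subseteq> {..<n + k i} \<and>
      R i = {as \<in> tuples M (n + k i). fm_sat M ((!) as) \<phi>}"
    using Sigma_rel_step.IH unfolding Sigma_definable_def by blast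
  from choice[OF this] obtain F where "\<forall>i. (\<exists>\<beta><\<alpha>. Sigma_in \<beta> (F i)) \<and> fm_in V (F i) \<and>
      fm_vars (F i) \<subseteq> {..<n + k i} \<and> R i = {as \<in> tuples M (n + k i). fm_sat M ((!) as) (F i)}" ..
  then have F: "\<exists>\<beta><\<alpha>. Sigma_in \<beta> (F i)" "fm_in V (F i)" "fm_vars (F i) \<subseteq> {..<n + k i}"
    and R: "R i = {as \<in> tuples M (n + k i). fm_sat M ((!) as) (F i)}" for i
    by blast+
  let ?\<phi> = "OrEx (\<lambda>i. [n..<n + k i]) (\<lambda>i. fm_dual (F i))"
  have "\<exists>\<beta><\<alpha>. Pi_in \<beta> (fm_dual (F i))" for i using F(1) Pi_in_dual by blast
  then have "Sigma_in \<alpha> ?\<phi>" by (rule Sigma_in_Pi_in.Sigma_step[OF \<open>0 < \<alpha>\<close>])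
  moreover have "fm_in V ?\<phi>" "fm_vars ?\<phi> \<subseteq> {..<n}"
    using F(2,3) by (fastforce simp: subset_iff)+
  moreover have "ext_outside M n UNIV k R = {as \<in> tuples M n. fm_sat M ((!) as) ?\<phi>}"
  proof -
    have "(\<exists>w\<in>reassign M [n..<n + k i] ((!) as). fm_sat M w (fm_dual (F i))) \<longleftrightarrow>
        (\<exists>bs\<in>tuples M (k i). as @ bs \<notin> R i)" if as: "as \<in> tuples M n" for as i
    proof -
      have F_cong: "fm_sat M v (fm_dual (F i)) = fm_sat M w (fm_dual (F i))"
        if "\<And>j. j < n + k i \<Longrightarrow> v j = w j" for v w
        using that F(3)[of i] by (intro fm_sat_cong) auto
      show ?thesis
        using Bex_reassign_upt[where Q = "\<lambda>w. fm_sat M w (fm_dual (F i))", OF F_cong as]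
        by (simp add: R tuples_append[OF as] cong: bex_cong)
    qed
    then show ?thesis unfolding ext_outside_def by (simp cong: conj_cong)
  qed
  ultimately show ?case unfolding Sigma_definable_def by blast
qed

theorem Sigma_definable_iff: "Sigma_definable V M \<alpha> n S \<longleftrightarrow> Sigma_rel V M \<alpha> n S"
proof
  assume "Sigma_definable V M \<alpha> n S"
  then show "Sigma_rel V M \<alpha> n S"
    unfolding Sigma_definable_def using Sigma_in_imp_Sigma_rel[of \<alpha> _ V "\<lambda>i. i" n M] by auto
qed (rule Sigma_rel_imp_Sigma_definable)

definition orbits_definable :: "('f, 'r) vocabulary \<Rightarrow> ('a, 'f, 'r) model \<Rightarrow> omega1 \<Rightarrow> bool"
  where "orbits_definable V M \<alpha> \<longleftrightarrow>
    (\<forall>as\<in>lists (univ M). Sigma_rel V M \<alpha> (length as) (orbit V M as))"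

lemma scott_rank_eq_Least: "scott_rank V M = Least (orbits_definable V M)"
  by (simp add: scott_rank_def orbits_definable_def[abs_def] Sigma_definable_iff)

lemma orbits_definable_mono: "orbits_definable V M \<alpha> \<Longrightarrow> \<alpha> \<le> \<beta> \<Longrightarrow> orbits_definable V M \<beta>"
  unfolding orbits_definable_def using Sigma_rel_mono by blast

section \<open>Automorphisms and back-and-forth systems\<close>

lemma tm_val_in_univ:
  assumes "is_model V M" "tm_in V t" "v ` tm_vars t \<subseteq> univ M"
  shows "tm_val M v t \<in> univ M"
  using assms(2,3)
proof (induction t)
  case (App f ts)
  have "tm_val M v t \<in> univ M" if "t \<in> set ts" for t
    using that App.prems by (intro App.IH) (auto simp: list_all_iff)
  then have "map (tm_val M v) ts \<in> tuples M (fun_arity V f)"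
    using App.prems by (auto simp: tuples_def)
  then show ?case using App.prems assms(1) by (simp add: is_model_def)
qed auto

lemma automorphism_tm_val:
  assumes "is_model V M" "automorphism V M g" "tm_in V t" "v ` tm_vars t \<subseteq> univ M"
  shows "tm_val M (\<lambda>i. g (v i)) t = g (tm_val M v t)"
  using assms(3,4)
proof (induction t)
  case (App f ts)
  have ts: "tm_val M v t \<in> univ M" "tm_val M (\<lambda>i. g (v i)) t = g (tm_val M v t)" if "t \<in> set ts" for t
    using that App tm_val_in_univ[OF assms(1), of t v] by (force simp: list_all_iff)+
  then have "map (tm_val M v) ts \<in> tuples M (fun_arity V f)"
    using App.prems by (auto simp: tuples_def)
  then have "g (fun_int M f (map (tm_val M v) ts)) = fun_int M f (map g (map (tm_val M v) ts))"
    using App.prems assms(2) by (simp add: automorphism_def)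
  also have "map g (map (tm_val M v) ts) = map (tm_val M (\<lambda>i. g (v i))) ts" using ts by simp
  finally show ?case by simp
qed simp

lemma automorphism_atom_sat:
  assumes "is_model V M" "automorphism V M g" "atom_in V a" "v ` atom_vars a \<subseteq> univ M"
  shows "atom_sat M (\<lambda>i. g (v i)) a \<longleftrightarrow> atom_sat M v a"
proof (cases a)
  case (Eq s t)
  have "tm_val M (\<lambda>i. g (v i)) s = g (tm_val M v s)" "tm_val M (\<lambda>i. g (v i)) t = g (tm_val M v t)"
    "tm_val M v s \<in> univ M" "tm_val M v t \<in> univ M"
    using assms Eq by (auto intro!: automorphism_tm_val tm_val_in_univ)
  moreover have "inj_on g (univ M)" using assms(2) by (simp add: automorphism_def bij_betw_def)
  ultimately show ?thesis using Eq by (simp add: inj_on_eq_iff)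
next
  case (Rel r ts)
  have "tm_val M v t \<in> univ M" "tm_val M (\<lambda>i. g (v i)) t = g (tm_val M v t)" if "t \<in> set ts" for t
    using that assms Rel by (force intro!: automorphism_tm_val tm_val_in_univ)+
  then have "map (tm_val M (\<lambda>i. g (v i))) ts = map g (map (tm_val M v) ts)"
    "map (tm_val M v) ts \<in> tuples M (rel_arity V r)"
    using Rel assms(3) by (auto simp: tuples_def)
  then show ?thesis using assms(2,3) Rel unfolding automorphism_def by (auto simp del: map_map)
qed

lemma automorphism_if_atom_sat:
  fixes M :: "('a, 'f, 'r) model"
  assumes model: "is_model V M" and bij: "bij_betw g (univ M) (univ M)"
    and atoms: "\<And>a v. atom_in V a \<Longrightarrow> v ` atom_vars a \<subseteq> univ M \<Longrightarrow>
      atom_sat M (\<lambda>i. g (v i)) a \<longleftrightarrow> atom_sat M v a"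
  shows "automorphism V M g"
proof -
  have map_nth_g: "map (\<lambda>i. g (as ! i)) [0..<length as] = map g as" for as
    by (rule nth_equalityI) simp_all
  have "g (fun_int M f as) = fun_int M f (map g as)"
    if f: "f \<in> Funs V" "as \<in> tuples M (fun_arity V f)" for f as
  proof -
    let ?v = "(!) (fun_int M f as # as)"
    let ?a = "Eq (Var 0) (App f (map (\<lambda>i. Var (Suc i)) [0..<length as])) :: ('f, 'r) atom"
    have "atom_in V ?a" using f by (auto simp: tuples_def list_all_iff)
    moreover have "fun_int M f as \<in> univ M" using f model by (simp add: is_model_def)
    then have "?v ` atom_vars ?a \<subseteq> univ M"
      using nth_in_univ[OF f(2)] f(2) by (auto simp: tuples_def)
    ultimately have "atom_sat M (\<lambda>i. g (?v i)) ?a \<longleftrightarrow> atom_sat M ?v ?a" by (rule atoms)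
    then show ?thesis by (simp add: comp_def map_nth map_nth_g)
  qed
  moreover have "rel_int M r (map g as) \<longleftrightarrow> rel_int M r as"
    if r: "r \<in> Rels V" "as \<in> tuples M (rel_arity V r)" for r as
  proof -
    let ?a = "Rel r (map Var [0..<length as]) :: ('f, 'r) atom"
    have "atom_in V ?a" using r by (auto simp: tuples_def)
    moreover have "(!) as ` atom_vars ?a \<subseteq> univ M"
      using nth_in_univ[OF r(2)] r(2) by (auto simp: tuples_def)
    ultimately have "atom_sat M (\<lambda>i. g (as ! i)) ?a \<longleftrightarrow> atom_sat M ((!) as) ?a" by (rule atoms)
    then show ?thesis by (simp add: comp_def map_nth map_nth_g)
  qed
  ultimately show ?thesis using bij by (simp add: automorphism_def)
qed

lemma automorphism_in_univ: "automorphism V M g \<Longrightarrow> a \<in> univ M \<Longrightarrow> g a \<in> univ M"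
  by (auto simp: automorphism_def bij_betw_def)

lemma automorphism_inv_into:
  fixes M :: "('a, 'f, 'r) model"
  assumes model: "is_model V M" and g: "automorphism V M g"
  shows "automorphism V M (inv_into (univ M) g)"
proof (rule automorphism_if_atom_sat[OF model])
  let ?h = "inv_into (univ M) g"
  have bij: "bij_betw g (univ M) (univ M)" using g by (simp add: automorphism_def)
  show "bij_betw ?h (univ M) (univ M)" using bij by (rule bij_betw_inv_into)
  fix a and v :: "nat \<Rightarrow> 'a" assume a: "atom_in V a" "v ` atom_vars a \<subseteq> univ M"
  have gh: "g (?h (v i)) = v i" "?h (v i) \<in> univ M" if "i \<in> atom_vars a" for i
    using that a(2) bij_betw_inv_into_right[OF bij] bij_betw_apply[OF bij_betw_inv_into[OF bij]] by auto
  then have "atom_sat M (\<lambda>i. ?h (v i)) a \<longleftrightarrow> atom_sat M (\<lambda>i. g (?h (v i))) a"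
    by (intro automorphism_atom_sat[OF model g a(1), symmetric]) auto
  also have "\<dots> \<longleftrightarrow> atom_sat M v a" using gh(1) by (rule atom_sat_cong)
  finally show "atom_sat M (\<lambda>i. ?h (v i)) a \<longleftrightarrow> atom_sat M v a" .
qed

lemma orbit_refl: "as \<in> orbit V M as"
proof -
  have "automorphism V M (\<lambda>a. a)" by (auto simp: automorphism_def bij_betw_def)
  then show ?thesis by (force simp: orbit_def)
qed

lemma orbit_sym:
  assumes "is_model V M" "as \<in> lists (univ M)" "bs \<in> orbit V M as"
  shows "as \<in> orbit V M bs"
proof -
  obtain g where g: "automorphism V M g" "bs = map g as" using assms(3) by (auto simp: orbit_def)
  then have "map (inv_into (univ M) g) bs = as"
    using assms(2)
    by (auto simp: automorphism_def in_lists_conv_set bij_betw_inv_into_left intro!: map_idI)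
  then show ?thesis using automorphism_inv_into[OF assms(1) g(1)] by (auto simp: orbit_def)
qed

lemma orbit_length: "bs \<in> orbit V M as \<Longrightarrow> length bs = length as"
  by (auto simp: orbit_def)

lemma orbit_take: "bs \<in> orbit V M as \<Longrightarrow> take k bs \<in> orbit V M (take k as)"
  by (auto simp: orbit_def take_map)

lemma orbit_subset: "as \<in> tuples M n \<Longrightarrow> orbit V M as \<subseteq> tuples M n"
  by (auto simp: orbit_def tuples_def automorphism_in_univ)

text \<open>An atomic formula is compared on long tuples only, because the label of a node of length \<open>n\<close>
  records no more than the first \<open>n\<close> atomic formulas.\<close>

definition back_and_forth_system ::
  "('f, 'r) vocabulary \<Rightarrow> ('a, 'f, 'r) model \<Rightarrow> ('a \<times> 'a) list set \<Rightarrow> bool"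
  where "back_and_forth_system V M \<I> \<longleftrightarrow>
    (\<forall>zs\<in>\<I>. set zs \<subseteq> univ M \<times> univ M \<and>
      (\<forall>a\<in>univ M. \<exists>b. zs @ [(a, b)] \<in> \<I>) \<and> (\<forall>b\<in>univ M. \<exists>a. zs @ [(a, b)] \<in> \<I>)) \<and>
    (\<forall>a. atom_in V a \<longrightarrow> (\<exists>N. \<forall>zs\<in>\<I>. N \<le> length zs \<longrightarrow> atom_vars a \<subseteq> {..<length zs} \<longrightarrow>
      (atom_sat M ((!) (map fst zs)) a \<longleftrightarrow> atom_sat M ((!) (map snd zs)) a)))"

locale back_and_forth_chain =
  fixes V :: "('f, 'r) vocabulary" and M :: "('a, 'f, 'r) model"
    and \<I> :: "('a \<times> 'a) list set" and Z :: "nat \<Rightarrow> ('a \<times> 'a) list"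
  assumes model: "is_model V M" and bf_system: "back_and_forth_system V M \<I>"
    and chain_in: "Z n \<in> \<I>" and chain_step: "strict_prefix (Z n) (Z (Suc n))"
    and chain_total: "univ M \<subseteq> (\<Union>n. fst ` set (Z n))" and chain_onto: "univ M \<subseteq> (\<Union>n. snd ` set (Z n))"
begin

lemma chain_prefix: "m \<le> n \<Longrightarrow> prefix (Z m) (Z n)"
proof (induction rule: dec_induct)
  case (step n)
  then show ?case using chain_step[of n] prefix_order.trans by auto
qed simp

lemma chain_length: "n \<le> length (Z n)"
proof (induction n)
  case (Suc n)
  then show ?case using prefix_length_less[OF chain_step[of n]] by simp
qed simp

definition graph :: "('a \<times> 'a) set"
  where "graph = (\<Union>n. set (Z n))"

lemma graph_subset: "graph \<subseteq> univ M \<times> univ M"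
  using chain_in bf_system unfolding graph_def back_and_forth_system_def by blast

lemma finite_subset_graphE:
  assumes "finite F" "F \<subseteq> graph"
  obtains n where "F \<subseteq> set (Z n)"
proof -
  have "subset.chain UNIV (range (\<lambda>n. set (Z n)))"
    unfolding subset.chain_def using set_mono_prefix[OF chain_prefix] nat_le_linear by blast
  moreover have "F \<subseteq> \<Union> (range (\<lambda>n. set (Z n)))" using assms(2) by (simp add: graph_def)
  ultimately obtain B where "B \<in> range (\<lambda>n. set (Z n))" "F \<subseteq> B"
    using finite_subset_Union_chain[OF assms(1)] by (metis UNIV_not_empty image_is_empty)
  then show ?thesis using that by blast
qed

lemma graph_atom_sat:
  assumes a: "atom_in V a" and vw: "\<And>i. i \<in> atom_vars a \<Longrightarrow> (v i, w i) \<in> graph"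
  shows "atom_sat M v a \<longleftrightarrow> atom_sat M w a"
proof -
  have "finite ((\<lambda>i. (v i, w i)) ` atom_vars a)" by (simp add: finite_atom_vars)
  then obtain n where n: "(\<lambda>i. (v i, w i)) ` atom_vars a \<subseteq> set (Z n)"
    by (rule finite_subset_graphE) (use vw in auto)
  have "\<forall>i\<in>atom_vars a. \<exists>j<length (Z n). Z n ! j = (v i, w i)"
    using n by (auto simp: in_set_conv_nth)
  then obtain \<rho> where \<rho>: "\<And>i. i \<in> atom_vars a \<Longrightarrow> \<rho> i < length (Z n) \<and> Z n ! \<rho> i = (v i, w i)"
    by metis
  let ?a = "atom_rename \<rho> a"
  obtain N where N: "\<And>zs. zs \<in> \<I> \<Longrightarrow> N \<le> length zs \<Longrightarrow> atom_vars ?a \<subseteq> {..<length zs} \<Longrightarrow>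
      atom_sat M ((!) (map fst zs)) ?a \<longleftrightarrow> atom_sat M ((!) (map snd zs)) ?a"
    using bf_system a unfolding back_and_forth_system_def by (metis atom_in_rename)
  let ?Z = "Z (max n N)"
  obtain zs where "?Z = Z n @ zs" using chain_prefix[of n "max n N"] by (auto simp: prefix_def)
  then have nth_Z: "\<rho> i < length ?Z \<and> ?Z ! \<rho> i = (v i, w i)" if "i \<in> atom_vars a" for i
    using \<rho>[OF that] by (auto simp: nth_append)
  have "atom_sat M v a \<longleftrightarrow> atom_sat M ((!) (map fst ?Z)) ?a"
    unfolding atom_sat_rename using nth_Z by (intro atom_sat_cong) auto
  also have "\<dots> \<longleftrightarrow> atom_sat M ((!) (map snd ?Z)) ?a"
    using chain_in chain_length[of "max n N"] nth_Z by (intro N) (auto simp: atom_vars_rename)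
  also have "\<dots> \<longleftrightarrow> atom_sat M w a"
    unfolding atom_sat_rename using nth_Z by (intro atom_sat_cong) auto
  finally show ?thesis .
qed

lemma graph_eq_iff:
  assumes "(a, b) \<in> graph" "(a', b') \<in> graph"
  shows "a = a' \<longleftrightarrow> b = b'"
  using graph_atom_sat[of "Eq (Var 0) (Var 1)" "\<lambda>i. if i = 0 then a else a'"
      "\<lambda>i. if i = 0 then b else b'"] assms by simp

lemma ex_automorphism_graph: "\<exists>g. automorphism V M g \<and> (\<forall>(a, b)\<in>graph. g a = b)"
proof -
  have "\<exists>b. (a, b) \<in> graph" if "a \<in> univ M" for a
    using that chain_total by (force simp: graph_def)
  then obtain g where g: "\<And>a. a \<in> univ M \<Longrightarrow> (a, g a) \<in> graph" by metis
  then have graph_g: "g a = b" if "(a, b) \<in> graph" for a b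
    using that graph_eq_iff[OF that] graph_subset by blast
  have "automorphism V M g"
  proof (rule automorphism_if_atom_sat[OF model])
    have "inj_on g (univ M)" using graph_eq_iff[OF g g] by (auto intro: inj_onI)
    moreover have "univ M \<subseteq> g ` univ M"
    proof
      fix b assume "b \<in> univ M"
      then obtain a where "(a, b) \<in> graph" using chain_onto by (force simp: graph_def)
      then show "b \<in> g ` univ M" using graph_g graph_subset by blast
    qed
    moreover have "g ` univ M \<subseteq> univ M" using g graph_subset by blast
    ultimately show "bij_betw g (univ M) (univ M)" by (auto simp: bij_betw_def)
    fix a and v :: "nat \<Rightarrow> 'a" assume "atom_in V a" "v ` atom_vars a \<subseteq> univ M"
    then show "atom_sat M (\<lambda>i. g (v i)) a \<longleftrightarrow> atom_sat M v a"
      using g by (intro graph_atom_sat[symmetric]) auto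
  qed
  then show ?thesis using graph_g by blast
qed

end

lemma ex_back_and_forth_chain:
  assumes model: "is_model V M" and "countable (univ M)"
    and bf: "back_and_forth_system V M \<I>" and zs: "zs \<in> \<I>"
  obtains Z where "back_and_forth_chain V M \<I> Z" "Z 0 = zs"
proof -
  define c where "c = from_nat_into (univ M)"
  have range_c: "range c = univ M"
    unfolding c_def using model assms(2) by (intro range_from_nat_into) (auto simp: is_model_def)
  let ?step = "\<lambda>n zs zs'. strict_prefix zs zs' \<and> c n \<in> fst ` set zs' \<and> c n \<in> snd ` set zs'"
  have "\<exists>zs'\<in>\<I>. ?step n zs zs'" if "zs \<in> \<I>" for n zs
  proof -
    have c: "c n \<in> univ M" using range_c by blast
    obtain b where b: "zs @ [(c n, b)] \<in> \<I>"
      using bf \<open>zs \<in> \<I>\<close> c unfolding back_and_forth_system_def by blast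
    obtain a where "(zs @ [(c n, b)]) @ [(a, c n)] \<in> \<I>"
      using bf b c unfolding back_and_forth_system_def by blast
    moreover have "?step n zs ((zs @ [(c n, b)]) @ [(a, c n)])" by (auto simp: strict_prefix_def)
    ultimately show ?thesis by blast
  qed
  then obtain Z where Z: "\<And>n. Z n \<in> \<I> \<and> (n = 0 \<longrightarrow> Z n = zs)"
    and step: "\<And>n. ?step n (Z n) (Z (Suc n))"
    using dependent_nat_choice[of "\<lambda>n zs'. zs' \<in> \<I> \<and> (n = 0 \<longrightarrow> zs' = zs)" ?step] zs
    by (metis nat.distinct(1))
  have "back_and_forth_chain V M \<I> Z"
  proof
    have "c n \<in> (\<Union>n. fst ` set (Z n))" "c n \<in> (\<Union>n. snd ` set (Z n))" for n
      using step[of n] by blast+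
    then show "univ M \<subseteq> (\<Union>n. fst ` set (Z n))" "univ M \<subseteq> (\<Union>n. snd ` set (Z n))"
      unfolding range_c[symmetric] by blast+
  qed (use model bf Z step in auto)
  then show ?thesis using that Z by blast
qed

theorem back_and_forth_orbit:
  assumes "is_model V M" "countable (univ M)" "back_and_forth_system V M \<I>" "zs \<in> \<I>"
  shows "map snd zs \<in> orbit V M (map fst zs)"
proof -
  obtain Z where "back_and_forth_chain V M \<I> Z" and Z0: "Z 0 = zs"
    by (rule ex_back_and_forth_chain[OF assms])
  then interpret back_and_forth_chain V M \<I> Z by simp
  obtain g where g: "automorphism V M g" "\<forall>(a, b)\<in>graph. g a = b"
    using ex_automorphism_graph by blast
  have "set zs \<subseteq> graph" using Z0 unfolding graph_def by blast
  then have "map snd zs = map g (map fst zs)" using g(2) by fastforce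
  then show ?thesis using g(1) unfolding orbit_def by blast
qed

section \<open>Labelled trees\<close>

abbreviation ancestor :: "nat \<Rightarrow> 'b list \<Rightarrow> 'b list"
  where "ancestor k \<equiv> butlast ^^ k"

lemma ancestor_ancestor: "ancestor k (ancestor l \<sigma>) = ancestor (k + l) \<sigma>"
  by (simp add: funpow_add)

lemma length_ancestor: "length (ancestor k \<sigma>) = length \<sigma> - k"
  by (simp add: butlast_power)

lemma set_ancestor_subset: "set (ancestor k \<sigma>) \<subseteq> set \<sigma>"
  by (simp add: butlast_power set_take_subset)

lemma map_ancestor: "map f (ancestor k \<sigma>) = ancestor k (map f \<sigma>)"
  by (simp add: butlast_power take_map)

lemma ancestor_Suc_snoc: "ancestor (Suc k) (\<sigma> @ [x]) = ancestor k \<sigma>"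
  by (simp add: funpow_Suc_right del: funpow.simps)

lemma ancestor_eq_ancestor_iff: "ancestor k \<sigma> = ancestor l \<sigma> \<longleftrightarrow> length \<sigma> - k = length \<sigma> - l"
  by (metis butlast_power length_ancestor)

lemma prefix_iff_ancestor: "prefix \<sigma> \<tau> \<longleftrightarrow> (\<exists>k\<le>length \<tau>. \<sigma> = ancestor k \<tau>)"
proof
  assume "prefix \<sigma> \<tau>"
  then obtain \<upsilon> where "\<tau> = \<sigma> @ \<upsilon>" by (auto simp: prefix_def)
  then show "\<exists>k\<le>length \<tau>. \<sigma> = ancestor k \<tau>"
    by (intro exI[of _ "length \<upsilon>"]) (simp add: butlast_power)
qed (auto simp: butlast_power take_is_prefix)

lemma tree_vocabulary_simps [simp]:
  "Funs tree_vocabulary = UNIV" "Rels tree_vocabulary = UNIV" "fun_arity tree_vocabulary f = 1"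
  "rel_arity tree_vocabulary Below = 2" "rel_arity tree_vocabulary (Label c) = 1"
  by (simp_all add: tree_vocabulary_def)

definition ancestor_tm :: "nat \<Rightarrow> nat \<Rightarrow> tree_fun tm"
  where "ancestor_tm k i = ((\<lambda>t. App Parent [t]) ^^ k) (Var i)"

lemma tm_vars_ancestor [simp]: "tm_vars (ancestor_tm k i) = {i}"
  by (induction k) (auto simp: ancestor_tm_def)

lemma tm_in_ancestor [simp]: "tm_in tree_vocabulary (ancestor_tm k i)"
  by (induction k) (auto simp: ancestor_tm_def)

lemma tm_in_tree_vocabularyE:
  assumes "tm_in tree_vocabulary t"
  obtains k i where "t = ancestor_tm k i"
proof -
  have "\<exists>k i. t = ancestor_tm k i"
    using assms
  proof (induction t)
    case (Var i)
    show ?case by (intro exI[of _ 0] exI[of _ i]) (simp add: ancestor_tm_def)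
  next
    case (App f ts)
    then obtain t where "ts = [t]" "tm_in tree_vocabulary t"
      by (auto simp: length_Suc_conv)
    moreover from this obtain k i where "t = ancestor_tm k i" using App.IH by auto
    ultimately show ?case
      by (intro exI[of _ "Suc k"] exI[of _ i]) (cases f, simp add: ancestor_tm_def)
  qed
  then show ?thesis using that by blast
qed

lemma atom_in_tree_vocabularyE:
  assumes "atom_in tree_vocabulary a"
  obtains k i l j where "a = Eq (ancestor_tm k i) (ancestor_tm l j)"
  | k i l j where "a = Rel Below [ancestor_tm k i, ancestor_tm l j]"
  | c k i where "a = Rel (Label c) [ancestor_tm k i]"
proof (cases a)
  case (Eq s t)
  then have "tm_in tree_vocabulary s" "tm_in tree_vocabulary t" using assms by simp_all
  then show ?thesis using that(1) Eq by (metis tm_in_tree_vocabularyE)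
next
  case (Rel r ts)
  then have ts: "\<forall>t\<in>set ts. tm_in tree_vocabulary t" "length ts = rel_arity tree_vocabulary r"
    using assms by simp_all
  show ?thesis
  proof (cases r)
    case Below
    then obtain s t where "ts = [s, t]"
      using ts(2) by (auto simp: numeral_2_eq_2 length_Suc_conv)
    then show ?thesis
      using that(2) Rel Below ts(1) by (metis list.set_intros tm_in_tree_vocabularyE)
  next
    case (Label c)
    then obtain t where "ts = [t]" using ts(2) by (auto simp: length_Suc_conv)
    then show ?thesis
      using that(3) Rel Label ts(1) by (metis list.set_intros(1) tm_in_tree_vocabularyE)
  qed
qed

lemma univ_labelled_tree [simp]: "univ (labelled_tree S lab) = S"
  by (simp add: labelled_tree_def)

lemma fun_int_labelled_tree: "fun_int (labelled_tree S lab) f [\<sigma>] = butlast \<sigma>"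
  by (simp add: labelled_tree_def)

lemma rel_int_labelled_tree:
  "rel_int (labelled_tree S lab) Below [\<sigma>, \<tau>] \<longleftrightarrow> prefix \<sigma> \<tau>"
  "rel_int (labelled_tree S lab) (Label c) [\<sigma>] \<longleftrightarrow> lab \<sigma> = c"
  by (simp_all add: labelled_tree_def)

lemma tm_val_labelled_tree: "tm_val (labelled_tree S lab) v (ancestor_tm k i) = ancestor k (v i)"
  by (induction k) (simp_all add: ancestor_tm_def fun_int_labelled_tree)

lemma atom_sat_labelled_tree:
  "atom_sat (labelled_tree S lab) v (Eq (ancestor_tm k i) (ancestor_tm l j)) \<longleftrightarrow>
    ancestor k (v i) = ancestor l (v j)"
  "atom_sat (labelled_tree S lab) v (Rel Below [ancestor_tm k i, ancestor_tm l j]) \<longleftrightarrow>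
    prefix (ancestor k (v i)) (ancestor l (v j))"
  "atom_sat (labelled_tree S lab) v (Rel (Label c) [ancestor_tm k i]) \<longleftrightarrow> lab (ancestor k (v i)) = c"
  by (simp_all add: tm_val_labelled_tree rel_int_labelled_tree)

lemma is_model_labelled_tree:
  assumes "S \<noteq> {}" "\<And>\<sigma>. \<sigma> \<in> S \<Longrightarrow> butlast \<sigma> \<in> S"
  shows "is_model tree_vocabulary (labelled_tree S lab)"
proof -
  have "fun_int (labelled_tree S lab) f \<sigma>s \<in> S" if "\<sigma>s \<in> tuples (labelled_tree S lab) 1" for f \<sigma>s
    using that assms(2) by (auto simp: tuples_Suc_0_iff fun_int_labelled_tree)
  then show ?thesis using assms(1) by (simp add: is_model_def)
qed

lemma labelled_tree_automorphism_label:
  assumes "automorphism tree_vocabulary (labelled_tree S lab) h" "\<sigma> \<in> S"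
  shows "lab (h \<sigma>) = lab \<sigma>"
proof -
  let ?T = "labelled_tree S lab"
  have "[\<sigma>] \<in> tuples ?T (rel_arity tree_vocabulary (Label c))" "Label c \<in> Rels tree_vocabulary" for c
    using assms(2) by (simp_all add: tuples_def)
  then have "rel_int ?T (Label c) (map h [\<sigma>]) \<longleftrightarrow> rel_int ?T (Label c) [\<sigma>]" for c
    using assms(1) unfolding automorphism_def by blast
  then show ?thesis by (simp add: rel_int_labelled_tree)
qed

lemma labelled_tree_automorphism_butlast:
  assumes "automorphism tree_vocabulary (labelled_tree S lab) h" "\<sigma> \<in> S"
  shows "h (butlast \<sigma>) = butlast (h \<sigma>)"
proof -
  let ?T = "labelled_tree S lab"
  have "[\<sigma>] \<in> tuples ?T (fun_arity tree_vocabulary Parent)" "Parent \<in> Funs tree_vocabulary"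
    using assms(2) by (simp_all add: tuples_def)
  then have "h (fun_int ?T Parent [\<sigma>]) = fun_int ?T Parent (map h [\<sigma>])"
    using assms(1) unfolding automorphism_def by blast
  then show ?thesis by (simp add: fun_int_labelled_tree)
qed

section \<open>Automorphisms of the tree of tuples\<close>

lemma tree_of_tuples_eq:
  "tree_of_tuples e A =
    labelled_tree {\<sigma>. map fst \<sigma> \<in> lists (univ A)} (\<lambda>\<sigma>. tuple_label e A (map fst \<sigma>))"
  by (simp add: tree_of_tuples_def replicated_tree_def)

lemma tuple_label_eq_iff:
  "tuple_label e A as = tuple_label e A bs \<longleftrightarrow>
    length as = length bs \<and> finite_diagram e A as = finite_diagram e A bs"
  by (auto simp: tuple_label_def)

lemma finite_diagram_nth:
  "i < length as \<Longrightarrow> finite_diagram e A as ! i \<longleftrightarrow>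
    atom_vars (e i) \<subseteq> {..<length as} \<and> atom_sat A ((!) as) (e i)"
  by (simp add: finite_diagram_def)

locale tuple_tree =
  fixes V :: "('f, 'r) vocabulary" and A :: "('a, 'f, 'r) model" and e :: "nat \<Rightarrow> ('f, 'r) atom"
  assumes model: "is_model V A" and countable_univ: "countable (univ A)"
    and enum: "enumerates_atoms V e"
begin

abbreviation T :: "(('a \<times> nat) list, tree_fun, tree_rel) model"
  where "T \<equiv> tree_of_tuples e A"

lemma in_univ_T: "\<sigma> \<in> univ T \<longleftrightarrow> map fst \<sigma> \<in> lists (univ A)"
  by (simp add: tree_of_tuples_eq)

lemma atom_sat_T:
  "atom_sat T v (Eq (ancestor_tm k i) (ancestor_tm l j)) \<longleftrightarrow> ancestor k (v i) = ancestor l (v j)"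
  "atom_sat T v (Rel Below [ancestor_tm k i, ancestor_tm l j]) \<longleftrightarrow>
    prefix (ancestor k (v i)) (ancestor l (v j))"
  "atom_sat T v (Rel (Label c) [ancestor_tm k i]) \<longleftrightarrow>
    tuple_label e A (map fst (ancestor k (v i))) = c"
  by (simp_all only: tree_of_tuples_eq atom_sat_labelled_tree)

lemma ancestor_in_univ_T: "\<sigma> \<in> univ T \<Longrightarrow> ancestor k \<sigma> \<in> univ T"
  by (force simp: in_univ_T butlast_power dest: in_set_takeD)

lemma is_model_T: "is_model tree_vocabulary T"
  unfolding tree_of_tuples_eq
  by (rule is_model_labelled_tree) (auto intro: exI[of _ "[]"] dest!: in_set_butlastD bspec)

lemma countable_univ_T: "countable (univ T)"
proof -
  have "univ T \<subseteq> lists (univ A \<times> UNIV)" by (force simp: in_univ_T)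
  moreover have "countable (lists (univ A \<times> (UNIV :: nat set)))"
    using countable_univ by (intro countable_lists countable_SIGMA) auto
  ultimately show ?thesis by (rule countable_subset)
qed

lemma atom_in_enum: "atom_in V (e i)"
  using enum by (auto simp: enumerates_atoms_def)

lemma ex_enum: "atom_in V a \<Longrightarrow> \<exists>i. e i = a"
  using enum unfolding enumerates_atoms_def by (metis mem_Collect_eq rangeE)

lemma tuple_label_orbit:
  assumes "as \<in> lists (univ A)" "bs \<in> orbit V A as"
  shows "tuple_label e A bs = tuple_label e A as"
proof -
  obtain g where g: "automorphism V A g" "bs = map g as" using assms(2) by (auto simp: orbit_def)
  have "atom_sat A ((!) bs) (e i) \<longleftrightarrow> atom_sat A ((!) as) (e i)"
    if vars: "atom_vars (e i) \<subseteq> {..<length as}" for i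
  proof -
    have "atom_sat A ((!) bs) (e i) \<longleftrightarrow> atom_sat A (\<lambda>j. g (as ! j)) (e i)"
      using vars by (intro atom_sat_cong) (auto simp: g(2))
    also have "\<dots> \<longleftrightarrow> atom_sat A ((!) as) (e i)"
      using vars assms(1) by (intro automorphism_atom_sat[OF model g(1) atom_in_enum]) auto
    finally show ?thesis .
  qed
  then have "finite_diagram e A bs = finite_diagram e A as"
    unfolding finite_diagram_def g(2) by auto
  then show ?thesis using g(2) by (simp add: tuple_label_eq_iff)
qed

lemma tree_automorphism_label:
  assumes "automorphism tree_vocabulary T h" "\<sigma> \<in> univ T"
  shows "tuple_label e A (map fst (h \<sigma>)) = tuple_label e A (map fst \<sigma>)"
  using labelled_tree_automorphism_label[OF assms(1)[unfolded tree_of_tuples_eq]] assms(2)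
  by (simp add: in_univ_T)

lemma tree_automorphism_length:
  "automorphism tree_vocabulary T h \<Longrightarrow> \<sigma> \<in> univ T \<Longrightarrow> length (h \<sigma>) = length \<sigma>"
  using tree_automorphism_label by (metis length_map tuple_label_eq_iff)

lemma tree_automorphism_ancestor:
  assumes h: "automorphism tree_vocabulary T h" and \<sigma>: "\<sigma> \<in> univ T"
  shows "h (ancestor k \<sigma>) = ancestor k (h \<sigma>)"
proof (induction k)
  case (Suc k)
  have "h (butlast (ancestor k \<sigma>)) = butlast (h (ancestor k \<sigma>))"
    using labelled_tree_automorphism_butlast[OF h[unfolded tree_of_tuples_eq]]
      ancestor_in_univ_T[OF \<sigma>]
    by (simp add: in_univ_T)
  then show ?case using Suc by simp
qed simp

lemma tree_automorphism_snoc: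
  assumes "automorphism tree_vocabulary T h" "\<sigma> @ [x] \<in> univ T"
  shows "\<exists>y. h (\<sigma> @ [x]) = h \<sigma> @ [y]"
proof -
  have "butlast (h (\<sigma> @ [x])) = h \<sigma>" using tree_automorphism_ancestor[OF assms, of 1] by simp
  moreover have "h (\<sigma> @ [x]) \<noteq> []" using tree_automorphism_length[OF assms] by auto
  ultimately show ?thesis by (metis append_butlast_last_id)
qed

lemma tree_automorphism_snoc_preimage:
  assumes h: "automorphism tree_vocabulary T h" and \<sigma>: "\<sigma> \<in> univ T" and y: "h \<sigma> @ [y] \<in> univ T"
  shows "\<exists>x. \<sigma> @ [x] \<in> univ T \<and> h (\<sigma> @ [x]) = h \<sigma> @ [y]"
proof -
  let ?h' = "inv_into (univ T) h"
  have h': "automorphism tree_vocabulary T ?h'" using automorphism_inv_into[OF is_model_T h] .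
  have bij: "bij_betw h (univ T) (univ T)" using h by (simp add: automorphism_def)
  obtain x where "?h' (h \<sigma> @ [y]) = ?h' (h \<sigma>) @ [x]"
    using tree_automorphism_snoc[OF h' y] by blast
  then have x: "?h' (h \<sigma> @ [y]) = \<sigma> @ [x]" using bij_betw_inv_into_left[OF bij \<sigma>] by simp
  have "\<sigma> @ [x] \<in> univ T" using automorphism_in_univ[OF h' y] x by simp
  moreover have "h (\<sigma> @ [x]) = h \<sigma> @ [y]" using bij_betw_inv_into_right[OF bij y] x by simp
  ultimately show ?thesis by blast
qed

lemma tree_automorphism_atom_sat:
  assumes "automorphism tree_vocabulary T h" "\<sigma> \<in> univ T"
    and "i < length \<sigma>" "atom_vars (e i) \<subseteq> {..<length \<sigma>}"
  shows "atom_sat A ((!) (map fst \<sigma>)) (e i) \<longleftrightarrow> atom_sat A ((!) (map fst (h \<sigma>))) (e i)"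
proof -
  have "length (h \<sigma>) = length \<sigma>" by (rule tree_automorphism_length[OF assms(1,2)])
  moreover have "finite_diagram e A (map fst \<sigma>) ! i = finite_diagram e A (map fst (h \<sigma>)) ! i"
    using tree_automorphism_label[OF assms(1,2)] by (simp add: tuple_label_eq_iff)
  ultimately show ?thesis using assms(3,4) by (simp add: finite_diagram_nth)
qed

lemma back_and_forth_system_tree_automorphism:
  assumes h: "automorphism tree_vocabulary T h"
  shows "back_and_forth_system V A {zip (map fst \<sigma>) (map fst (h \<sigma>)) |\<sigma>. \<sigma> \<in> univ T}"
    (is "back_and_forth_system V A ?\<I>")
  unfolding back_and_forth_system_def
proof (intro conjI ballI allI impI)
  fix zs assume "zs \<in> ?\<I>"
  then obtain \<sigma> where \<sigma>: "\<sigma> \<in> univ T" and zs: "zs = zip (map fst \<sigma>) (map fst (h \<sigma>))" by blast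
  note h_univ = automorphism_in_univ[OF h \<sigma>] and len = tree_automorphism_length[OF h \<sigma>]
  have "set zs \<subseteq> set (map fst \<sigma>) \<times> set (map fst (h \<sigma>))"
    unfolding zs by (auto dest: set_zip_leftD set_zip_rightD)
  then show "set zs \<subseteq> univ A \<times> univ A" using \<sigma> h_univ unfolding in_univ_T by blast
  fix a assume a: "a \<in> univ A"
  have child: "\<sigma> @ [(a, 0)] \<in> univ T" using \<sigma> a by (simp add: in_univ_T)
  then obtain y where "h (\<sigma> @ [(a, 0)]) = h \<sigma> @ [y]" using tree_automorphism_snoc[OF h] by blast
  then have "zs @ [(a, fst y)] = zip (map fst (\<sigma> @ [(a, 0)])) (map fst (h (\<sigma> @ [(a, 0)])))"
    using len by (simp add: zs)
  then show "\<exists>b. zs @ [(a, b)] \<in> ?\<I>" using child by blast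
next
  fix zs b assume "zs \<in> ?\<I>" and b: "b \<in> univ A"
  then obtain \<sigma> where \<sigma>: "\<sigma> \<in> univ T" and zs: "zs = zip (map fst \<sigma>) (map fst (h \<sigma>))" by blast
  have "h \<sigma> @ [(b, 0)] \<in> univ T" using automorphism_in_univ[OF h \<sigma>] b by (simp add: in_univ_T)
  then obtain x where x: "\<sigma> @ [x] \<in> univ T" "h (\<sigma> @ [x]) = h \<sigma> @ [(b, 0)]"
    using tree_automorphism_snoc_preimage[OF h \<sigma>] by blast
  then have "zs @ [(fst x, b)] = zip (map fst (\<sigma> @ [x])) (map fst (h (\<sigma> @ [x])))"
    using tree_automorphism_length[OF h \<sigma>] by (simp add: zs)
  then show "\<exists>a. zs @ [(a, b)] \<in> ?\<I>" using x(1) by blast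
next
  fix a assume "atom_in V a"
  then obtain j where j: "e j = a" using ex_enum by blast
  have "atom_sat A ((!) (map fst zs)) a \<longleftrightarrow> atom_sat A ((!) (map snd zs)) a"
    if zs: "zs \<in> ?\<I>" and len: "Suc j \<le> length zs" and vars: "atom_vars a \<subseteq> {..<length zs}" for zs
  proof -
    obtain \<sigma> where \<sigma>: "\<sigma> \<in> univ T" "zs = zip (map fst \<sigma>) (map fst (h \<sigma>))" using zs by blast
    then show ?thesis
      using tree_automorphism_atom_sat[OF h \<sigma>(1), of j] tree_automorphism_length[OF h \<sigma>(1)]
        len vars j by simp
  qed
  then show "\<exists>N. \<forall>zs\<in>?\<I>. N \<le> length zs \<longrightarrow> atom_vars a \<subseteq> {..<length zs} \<longrightarrow>
      (atom_sat A ((!) (map fst zs)) a \<longleftrightarrow> atom_sat A ((!) (map snd zs)) a)" by blast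
qed

lemma tree_automorphism_orbit:
  assumes h: "automorphism tree_vocabulary T h" and \<sigma>: "\<sigma> \<in> univ T"
  shows "map fst (h \<sigma>) \<in> orbit V A (map fst \<sigma>)"
proof -
  have "zip (map fst \<sigma>) (map fst (h \<sigma>)) \<in> {zip (map fst \<sigma>) (map fst (h \<sigma>)) |\<sigma>. \<sigma> \<in> univ T}"
    using \<sigma> by blast
  from back_and_forth_orbit[OF model countable_univ back_and_forth_system_tree_automorphism[OF h] this]
  show ?thesis using tree_automorphism_length[OF h \<sigma>] by simp
qed

definition tree_sim :: "(('a \<times> nat) list \<times> ('a \<times> nat) list) set \<Rightarrow> bool"
  where "tree_sim Z \<longleftrightarrow>
    (\<forall>(\<sigma>, \<sigma>')\<in>Z. \<sigma> \<in> univ T \<and> \<sigma>' \<in> univ T \<and> map fst \<sigma>' \<in> orbit V A (map fst \<sigma>)) \<and>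
    (\<forall>(\<sigma>, \<sigma>')\<in>Z. \<forall>(\<tau>, \<tau>')\<in>Z. \<forall>k l. ancestor k \<sigma> = ancestor l \<tau> \<longleftrightarrow> ancestor k \<sigma>' = ancestor l \<tau>')"

lemma tree_simD:
  assumes "tree_sim Z" "(\<sigma>, \<sigma>') \<in> Z"
  shows "\<sigma> \<in> univ T" "\<sigma>' \<in> univ T" "map fst \<sigma>' \<in> orbit V A (map fst \<sigma>)" "length \<sigma>' = length \<sigma>"
proof -
  show "\<sigma> \<in> univ T" "\<sigma>' \<in> univ T" and orb: "map fst \<sigma>' \<in> orbit V A (map fst \<sigma>)"
    using assms unfolding tree_sim_def by auto
  show "length \<sigma>' = length \<sigma>" using orbit_length[OF orb] by simp
qed

lemma tree_sim_ancestor: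
  "tree_sim Z \<Longrightarrow> (\<sigma>, \<sigma>') \<in> Z \<Longrightarrow> (\<tau>, \<tau>') \<in> Z \<Longrightarrow>
    ancestor k \<sigma> = ancestor l \<tau> \<longleftrightarrow> ancestor k \<sigma>' = ancestor l \<tau>'"
  unfolding tree_sim_def by blast

lemma tree_sim_subset: "tree_sim Z \<Longrightarrow> Y \<subseteq> Z \<Longrightarrow> tree_sim Y"
  unfolding tree_sim_def by blast

lemma tree_sim_swap:
  assumes "tree_sim Z"
  shows "tree_sim (prod.swap ` Z)"
proof -
  have "map fst \<sigma> \<in> orbit V A (map fst \<sigma>')" if "(\<sigma>, \<sigma>') \<in> Z" for \<sigma> \<sigma>'
    using tree_simD[OF assms that] orbit_sym[OF model] in_univ_T by blast
  then show ?thesis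
    using tree_simD(1,2)[OF assms] tree_sim_ancestor[OF assms] unfolding tree_sim_def by auto
qed

lemma orbit_ancestor:
  "map fst \<sigma>' \<in> orbit V A (map fst \<sigma>) \<Longrightarrow>
    map fst (ancestor k \<sigma>') \<in> orbit V A (map fst (ancestor k \<sigma>))"
  using orbit_take[of "map fst \<sigma>'" V A "map fst \<sigma>" "length \<sigma> - k"]
    orbit_length[of "map fst \<sigma>'" V A "map fst \<sigma>"]
  by (simp add: butlast_power take_map)

definition ancestor_closure :: "('b list \<times> 'b list) set \<Rightarrow> ('b list \<times> 'b list) set"
  where "ancestor_closure Z = {(ancestor k \<sigma>, ancestor k \<sigma>') |k \<sigma> \<sigma>'. (\<sigma>, \<sigma>') \<in> Z}"

lemma subset_ancestor_closure: "Z \<subseteq> ancestor_closure Z"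
  unfolding ancestor_closure_def by (force intro: exI[of _ 0])

lemma ancestor_closure_closed:
  assumes "(\<sigma>, \<sigma>') \<in> ancestor_closure Z"
  shows "(ancestor k \<sigma>, ancestor k \<sigma>') \<in> ancestor_closure Z"
proof -
  obtain l \<rho> \<rho>' where \<rho>: "(\<rho>, \<rho>') \<in> Z" and "\<sigma> = ancestor l \<rho>" "\<sigma>' = ancestor l \<rho>'"
    using assms unfolding ancestor_closure_def by blast
  then have "ancestor k \<sigma> = ancestor (k + l) \<rho>" "ancestor k \<sigma>' = ancestor (k + l) \<rho>'"
    by (simp_all add: ancestor_ancestor)
  then show ?thesis using \<rho> unfolding ancestor_closure_def by blast
qed

lemma Range_ancestor_closureE:
  assumes "\<rho> \<in> Range (ancestor_closure Z)"
  obtains \<sigma>' where "\<sigma>' \<in> Range Z" "set \<rho> \<subseteq> set \<sigma>'"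
proof -
  obtain k \<sigma> \<sigma>' where "(\<sigma>, \<sigma>') \<in> Z" "\<rho> = ancestor k \<sigma>'"
    using assms unfolding ancestor_closure_def by blast
  then show ?thesis using set_ancestor_subset[of k \<sigma>'] by (intro that[of \<sigma>']) auto
qed

lemma tree_sim_ancestor_closure:
  assumes "tree_sim Z"
  shows "tree_sim (ancestor_closure Z)"
  unfolding tree_sim_def ancestor_closure_def
  using tree_simD[OF assms] tree_sim_ancestor[OF assms]
  by (auto simp: ancestor_in_univ_T ancestor_ancestor intro: orbit_ancestor)

lemma tree_sim_insert:
  assumes sim: "tree_sim Z" and \<tau>: "\<tau> \<in> univ T" "\<tau>' \<in> univ T" "map fst \<tau>' \<in> orbit V A (map fst \<tau>)"
    and anc: "\<And>\<sigma> \<sigma>' k l. (\<sigma>, \<sigma>') \<in> Z \<Longrightarrow> ancestor k \<sigma> = ancestor l \<tau> \<longleftrightarrow> ancestor k \<sigma>' = ancestor l \<tau>'"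
  shows "tree_sim (insert (\<tau>, \<tau>') Z)"
proof -
  have "length \<tau>' = length \<tau>" using orbit_length[OF \<tau>(3)] by simp
  then have "ancestor k \<tau> = ancestor l \<tau> \<longleftrightarrow> ancestor k \<tau>' = ancestor l \<tau>'" for k l
    by (simp add: ancestor_eq_ancestor_iff)
  moreover have "ancestor l \<tau> = ancestor k \<sigma> \<longleftrightarrow> ancestor l \<tau>' = ancestor k \<sigma>'"
    if "(\<sigma>, \<sigma>') \<in> Z" for \<sigma> \<sigma>' k l
    using anc[OF that, of k l] by (simp add: eq_commute)
  ultimately show ?thesis
    using \<tau> anc tree_simD[OF sim] tree_sim_ancestor[OF sim] unfolding tree_sim_def by auto
qed

text \<open>This is where the replication of branches is needed: the image of a new child gets a copy
  number that occurs in no image so far.\<close>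

lemma tree_sim_insert_child:
  assumes sim: "tree_sim Z" and closed: "\<And>\<sigma> \<sigma>' k. (\<sigma>, \<sigma>') \<in> Z \<Longrightarrow> (ancestor k \<sigma>, ancestor k \<sigma>') \<in> Z"
    and \<tau>: "(\<tau>, \<tau>') \<in> Z" and x: "\<tau> @ [x] \<in> univ T" "\<tau> @ [x] \<notin> Domain Z"
    and fresh: "\<And>\<sigma>'. \<sigma>' \<in> Range Z \<Longrightarrow> c \<notin> snd ` set \<sigma>'"
  shows "\<exists>b. tree_sim (insert (\<tau> @ [x], \<tau>' @ [(b, c)]) Z)"
proof -
  obtain g where g: "automorphism V A g" "map fst \<tau>' = map g (map fst \<tau>)"
    using tree_simD(3)[OF sim \<tau>] by (auto simp: orbit_def)
  let ?\<rho> = "\<tau>' @ [(g (fst x), c)]"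
  have "tree_sim (insert (\<tau> @ [x], ?\<rho>) Z)"
  proof (rule tree_sim_insert[OF sim x(1)])
    show "?\<rho> \<in> univ T"
      using x(1) tree_simD(2)[OF sim \<tau>] automorphism_in_univ[OF g(1)] by (auto simp: in_univ_T)
    have "map fst ?\<rho> = map g (map fst (\<tau> @ [x]))" using g(2) by simp
    then show "map fst ?\<rho> \<in> orbit V A (map fst (\<tau> @ [x]))" using g(1) by (auto simp: orbit_def)
    fix \<sigma> \<sigma>' k l assume \<sigma>: "(\<sigma>, \<sigma>') \<in> Z"
    show "ancestor k \<sigma> = ancestor l (\<tau> @ [x]) \<longleftrightarrow> ancestor k \<sigma>' = ancestor l ?\<rho>"
    proof (cases l)
      case 0
      have "ancestor k \<sigma> \<noteq> \<tau> @ [x]" using closed[OF \<sigma>, of k] x(2) by auto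
      moreover have "ancestor k \<sigma>' \<noteq> ?\<rho>" using closed[OF \<sigma>, of k] fresh[of ?\<rho>] by force
      ultimately show ?thesis using 0 by simp
    next
      case (Suc l')
      then show ?thesis
        using tree_sim_ancestor[OF sim \<sigma> \<tau>] by (simp add: ancestor_Suc_snoc del: funpow.simps)
    qed
  qed
  then show ?thesis by blast
qed

lemma tree_sim_extend:
  assumes sim: "tree_sim Z" and fin: "finite Z" and "\<tau> \<in> univ T"
  shows "\<exists>\<tau>'. tree_sim (insert (\<tau>, \<tau>') Z)"
  using \<open>\<tau> \<in> univ T\<close>
proof (induction \<tau> rule: rev_induct)
  case Nil
  have "ancestor k \<sigma> = ancestor l [] \<longleftrightarrow> ancestor k \<sigma>' = ancestor l []" if "(\<sigma>, \<sigma>') \<in> Z" for \<sigma> \<sigma>' k l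
    using tree_simD(4)[OF sim that] by (auto simp: butlast_power)
  then have "tree_sim (insert ([], []) Z)"
    using Nil orbit_refl[of "[]"] by (intro tree_sim_insert[OF sim]) simp_all
  then show ?case by blast
next
  case (snoc x \<tau>)
  have "\<tau> \<in> univ T" using snoc.prems by (simp add: in_univ_T)
  then obtain \<tau>' where sim': "tree_sim (insert (\<tau>, \<tau>') Z)" using snoc.IH by blast
  define Y where "Y = ancestor_closure (insert (\<tau>, \<tau>') Z)"
  have sim_Y: "tree_sim Y" unfolding Y_def using sim' by (rule tree_sim_ancestor_closure)
  have closed: "(ancestor k \<sigma>, ancestor k \<sigma>') \<in> Y" if "(\<sigma>, \<sigma>') \<in> Y" for \<sigma> \<sigma>' k
    using that unfolding Y_def by (rule ancestor_closure_closed)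
  have sub: "insert (\<tau>, \<tau>') Z \<subseteq> Y" unfolding Y_def by (rule subset_ancestor_closure)
  have restrict: ?case if "tree_sim W" "insert (\<tau> @ [x], \<rho>) Y \<subseteq> W" for W \<rho>
  proof -
    have "insert (\<tau> @ [x], \<rho>) Z \<subseteq> W" using that(2) sub by blast
    then show ?thesis using tree_sim_subset[OF that(1)] by blast
  qed
  show ?case
  proof (cases "\<tau> @ [x] \<in> Domain Y")
    case True
    then obtain \<rho> where "(\<tau> @ [x], \<rho>) \<in> Y" by blast
    then show ?thesis by (intro restrict[OF sim_Y]) simp
  next
    case False
    have "finite (\<Union>\<sigma>'\<in>Range (insert (\<tau>, \<tau>') Z). snd ` set \<sigma>')" using fin by (simp add: finite_Range)
    then obtain c where c: "c \<notin> (\<Union>\<sigma>'\<in>Range (insert (\<tau>, \<tau>') Z). snd ` set \<sigma>')"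
      using ex_new_if_finite[OF infinite_UNIV_nat] by blast
    have fresh: "c \<notin> snd ` set \<rho>" if "\<rho> \<in> Range Y" for \<rho>
      using that unfolding Y_def by (rule Range_ancestor_closureE) (use c in blast)
    have "(\<tau>, \<tau>') \<in> Y" using sub by blast
    from tree_sim_insert_child[OF sim_Y closed this snoc.prems False fresh]
    obtain b where "tree_sim (insert (\<tau> @ [x], \<tau>' @ [(b, c)]) Y)" ..
    then show ?thesis by (rule restrict) (rule order_refl)
  qed
qed

lemma tree_sim_prefix:
  assumes "tree_sim Z" "(\<sigma>, \<sigma>') \<in> Z" "(\<tau>, \<tau>') \<in> Z"
  shows "prefix (ancestor k \<sigma>) (ancestor l \<tau>) \<longleftrightarrow> prefix (ancestor k \<sigma>') (ancestor l \<tau>')"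
  using tree_sim_ancestor[OF assms] tree_simD(4)[OF assms(1,3)]
  by (simp add: prefix_iff_ancestor ancestor_ancestor length_ancestor)

lemma tree_sim_atom_sat:
  assumes sim: "tree_sim (set zs)" and a: "atom_in tree_vocabulary a" "atom_vars a \<subseteq> {..<length zs}"
  shows "atom_sat T ((!) (map fst zs)) a \<longleftrightarrow> atom_sat T ((!) (map snd zs)) a"
proof -
  have mem: "(fst (zs ! i), snd (zs ! i)) \<in> set zs" if "i < length zs" for i using that by simp
  from a(1) show ?thesis
  proof (cases rule: atom_in_tree_vocabularyE)
    case (1 k i l j)
    then show ?thesis
      using a(2) tree_sim_ancestor[OF sim mem mem] by (simp add: atom_sat_T del: atom_sat.simps)
  next
    case (2 k i l j)
    then show ?thesis
      using a(2) tree_sim_prefix[OF sim mem mem] by (simp add: atom_sat_T del: atom_sat.simps)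
  next
    case (3 c k i)
    then have i: "i < length zs" using a(2) by simp
    have "map fst (ancestor k (fst (zs ! i))) \<in> lists (univ A)"
      using ancestor_in_univ_T[OF tree_simD(1)[OF sim mem[OF i]]] in_univ_T by blast
    then have "tuple_label e A (map fst (ancestor k (snd (zs ! i)))) =
        tuple_label e A (map fst (ancestor k (fst (zs ! i))))"
      by (rule tuple_label_orbit[OF _ orbit_ancestor[OF tree_simD(3)[OF sim mem[OF i]]]])
    then show ?thesis using 3 i by (simp add: atom_sat_T del: atom_sat.simps)
  qed
qed

lemma back_and_forth_system_tree_sim:
  "back_and_forth_system tree_vocabulary T {zs. tree_sim (set zs)}"
  unfolding back_and_forth_system_def
proof (intro conjI ballI allI impI)
  fix zs assume "zs \<in> {zs. tree_sim (set zs)}"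
  then have sim: "tree_sim (set zs)" by simp
  show "set zs \<subseteq> univ T \<times> univ T" using tree_simD(1,2)[OF sim] by auto
  fix \<tau> assume "\<tau> \<in> univ T"
  then show "\<exists>\<tau>'. zs @ [(\<tau>, \<tau>')] \<in> {zs. tree_sim (set zs)}"
    using tree_sim_extend[OF sim] by simp
next
  fix zs \<tau> assume "zs \<in> {zs. tree_sim (set zs)}" and \<tau>: "\<tau> \<in> univ T"
  then have "tree_sim (prod.swap ` set zs)" by (simp add: tree_sim_swap)
  then obtain \<tau>' where "tree_sim (insert (\<tau>, \<tau>') (prod.swap ` set zs))"
    using tree_sim_extend[OF _ _ \<tau>] by blast
  then have "tree_sim (insert (\<tau>', \<tau>) (set zs))"
    using tree_sim_swap by (fastforce simp: image_image)
  then show "\<exists>\<tau>'. zs @ [(\<tau>', \<tau>)] \<in> {zs. tree_sim (set zs)}" by auto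
next
  fix a assume "atom_in tree_vocabulary a"
  then show "\<exists>N. \<forall>zs\<in>{zs. tree_sim (set zs)}. N \<le> length zs \<longrightarrow> atom_vars a \<subseteq> {..<length zs} \<longrightarrow>
      (atom_sat T ((!) (map fst zs)) a \<longleftrightarrow> atom_sat T ((!) (map snd zs)) a)"
    using tree_sim_atom_sat by blast
qed

theorem orbit_tree_iff:
  assumes \<sigma>s: "\<sigma>s \<in> tuples T m"
  shows "\<sigma>s' \<in> orbit tree_vocabulary T \<sigma>s \<longleftrightarrow> \<sigma>s' \<in> tuples T m \<and> tree_sim (set (zip \<sigma>s \<sigma>s'))"
proof
  assume orb: "\<sigma>s' \<in> orbit tree_vocabulary T \<sigma>s"
  then obtain h where h: "automorphism tree_vocabulary T h" and \<sigma>s': "\<sigma>s' = map h \<sigma>s"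
    by (auto simp: orbit_def)
  have univ: "\<sigma> \<in> univ T" if "\<sigma> \<in> set \<sigma>s" for \<sigma> using \<sigma>s that by (auto simp: tuples_def)
  have "inj_on h (univ T)" using h by (simp add: automorphism_def bij_betw_def)
  then have "ancestor k \<sigma> = ancestor l \<tau> \<longleftrightarrow> ancestor k (h \<sigma>) = ancestor l (h \<tau>)"
    if "\<sigma> \<in> univ T" "\<tau> \<in> univ T" for \<sigma> \<tau> k l
    using that by (metis tree_automorphism_ancestor[OF h] ancestor_in_univ_T inj_on_eq_iff)
  then have "tree_sim ((\<lambda>\<sigma>. (\<sigma>, h \<sigma>)) ` set \<sigma>s)"
    unfolding tree_sim_def using univ automorphism_in_univ[OF h] tree_automorphism_orbit[OF h] by auto
  moreover have "set (zip \<sigma>s \<sigma>s') = (\<lambda>\<sigma>. (\<sigma>, h \<sigma>)) ` set \<sigma>s"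
    unfolding \<sigma>s' by (simp add: zip_map2 zip_same_conv_map image_image)
  ultimately show "\<sigma>s' \<in> tuples T m \<and> tree_sim (set (zip \<sigma>s \<sigma>s'))"
    using orb orbit_subset[OF \<sigma>s] by auto
next
  assume sim: "\<sigma>s' \<in> tuples T m \<and> tree_sim (set (zip \<sigma>s \<sigma>s'))"
  then have "map snd (zip \<sigma>s \<sigma>s') \<in> orbit tree_vocabulary T (map fst (zip \<sigma>s \<sigma>s'))"
    by (intro back_and_forth_orbit[OF is_model_T countable_univ_T back_and_forth_system_tree_sim]) simp
  moreover have "length \<sigma>s = length \<sigma>s'" using sim \<sigma>s by (simp add: tuples_def)
  ultimately show "\<sigma>s' \<in> orbit tree_vocabulary T \<sigma>s" by simp
qed

lemma orbit_node_iff: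
  assumes "\<sigma> \<in> univ T" "\<sigma>' \<in> univ T"
  shows "[\<sigma>'] \<in> orbit tree_vocabulary T [\<sigma>] \<longleftrightarrow> map fst \<sigma>' \<in> orbit V A (map fst \<sigma>)"
proof -
  have "tree_sim {(\<sigma>, \<sigma>')} \<longleftrightarrow> map fst \<sigma>' \<in> orbit V A (map fst \<sigma>)"
    using tree_sim_insert[of "{}" \<sigma> \<sigma>'] assms tree_simD(3) by (auto simp: tree_sim_def)
  then show ?thesis using orbit_tree_iff[of "[\<sigma>]" 1 "[\<sigma>']"] assms by (simp add: tuples_Suc_0_iff)
qed

section \<open>From the tree to the structure\<close>

text \<open>A node is coded relative to a tuple of \<open>A\<close> by the list of the positions of its entries in the
  tuple together with their copy numbers.\<close>

definition node_at :: "'a list \<Rightarrow> (nat \<times> nat) list \<Rightarrow> ('a \<times> nat) list"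
  where "node_at as \<nu> = map (\<lambda>(p, c). (as ! p, c)) \<nu>"

definition node_codes :: "nat \<Rightarrow> (nat \<times> nat) list set"
  where "node_codes m = lists ({..<m} \<times> UNIV)"

lemma map_fst_node_at: "map fst (node_at as \<nu>) = map ((!) as) (map fst \<nu>)"
  by (auto simp: node_at_def)

lemma ancestor_node_at: "ancestor k (node_at as \<nu>) = node_at as (ancestor k \<nu>)"
  by (simp add: node_at_def map_ancestor)

lemma ancestor_in_node_codes: "\<nu> \<in> node_codes m \<Longrightarrow> ancestor k \<nu> \<in> node_codes m"
  unfolding node_codes_def using set_ancestor_subset[of k \<nu>] by blast

lemma node_at_in_univ_T: "as \<in> tuples A m \<Longrightarrow> \<nu> \<in> node_codes m \<Longrightarrow> node_at as \<nu> \<in> univ T"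
  by (force simp: in_univ_T map_fst_node_at node_codes_def intro: nth_in_univ)

lemma node_at_append:
  assumes "length as = m" "\<nu> \<in> node_codes m"
  shows "node_at (as @ bs) \<nu> = node_at as \<nu>"
  using assms by (auto simp: node_at_def node_codes_def nth_append)

lemma qf_definable_node_at_eq:
  assumes "\<nu> \<in> node_codes m" "\<nu>' \<in> node_codes m"
  shows "qf_definable V A m (\<lambda>as. node_at as \<nu> = node_at as \<nu>')"
proof -
  have "qf_definable V A m (\<lambda>as. as ! p = as ! q)" if "p < m" "q < m" for p q
    using qf_definable_atom_sat[of V "Eq (Var 0) (Var 1)" "\<lambda>i. if i = 0 then p else q" m A] that by simp
  moreover have "fst (\<nu> ! i) < m" if "i < length \<nu>" for i
    using assms(1) nth_mem[OF that] by (force simp: node_codes_def simp del: nth_mem)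
  moreover have "fst (\<nu>' ! i) < m" if "i < length \<nu>'" for i
    using assms(2) nth_mem[OF that] by (force simp: node_codes_def simp del: nth_mem)
  ultimately have "qf_definable V A m (\<lambda>as. length \<nu> = length \<nu>' \<and>
      (\<forall>i\<in>{..<min (length \<nu>) (length \<nu>')}.
        as ! fst (\<nu> ! i) = as ! fst (\<nu>' ! i) \<and> snd (\<nu> ! i) = snd (\<nu>' ! i)))"
    by (intro qf_definable_conj qf_definable_const qf_definable_Ball) auto
  then show ?thesis
    by (rule qf_definable_cong) (auto simp: node_at_def list_eq_iff_nth_eq split_def)
qed

lemma qf_definable_node_at_prefix:
  assumes "\<nu> \<in> node_codes m" "\<nu>' \<in> node_codes m"
  shows "qf_definable V A m (\<lambda>as. prefix (node_at as \<nu>) (node_at as \<nu>'))"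
proof -
  have "qf_definable V A m (\<lambda>as. \<exists>k\<in>{..length \<nu>'}. node_at as \<nu> = node_at as (ancestor k \<nu>'))"
    using assms by (intro qf_definable_Bex qf_definable_node_at_eq ancestor_in_node_codes) simp_all
  then show ?thesis
    by (rule qf_definable_cong)
      (auto simp: prefix_iff_ancestor ancestor_node_at, auto simp: node_at_def)
qed

lemma qf_definable_tuple_label:
  assumes "set ps \<subseteq> {..<m}"
  shows "qf_definable V A m (\<lambda>as. tuple_label e A (map ((!) as) ps) = c)"
proof -
  let ?k = "length ps"
  let ?P = "\<lambda>i as. atom_vars (e i) \<subseteq> {..<?k} \<and> atom_sat A (\<lambda>j. as ! (ps ! j)) (e i)"
  have "qf_definable V A m (?P i)" for i
  proof (cases "atom_vars (e i) \<subseteq> {..<?k}")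
    case True
    then have "(!) ps ` atom_vars (e i) \<subseteq> {..<m}" using assms by (rule nth_image_subset)
    then show ?thesis
      by (intro qf_definable_conj qf_definable_const qf_definable_atom_sat atom_in_enum)
  next
    case False
    then show ?thesis using qf_definable_const[of V A m False] by simp
  qed
  then have "qf_definable V A m (\<lambda>as. to_nat (?k, map (\<lambda>i. ?P i as) [0..<?k]) = c)"
    by (rule qf_definable_map_upt)
  moreover have "atom_sat A (\<lambda>j. as ! (ps ! j)) (e i) \<longleftrightarrow> atom_sat A ((!) (map ((!) as) ps)) (e i)"
    if "atom_vars (e i) \<subseteq> {..<?k}" for i as
    using that by (intro atom_sat_cong) auto
  ultimately show ?thesis by (simp add: tuple_label_def finite_diagram_def cong: conj_cong)
qed

lemma ex_node_codes:
  assumes "\<tau>s \<in> tuples T k" "length as = m"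
  obtains bs \<mu>s where "bs \<in> lists (univ A)" "length \<mu>s = k" "set \<mu>s \<subseteq> node_codes (m + length bs)"
    "map (node_at (as @ bs)) \<mu>s = \<tau>s"
proof -
  let ?bs = "concat (map (map fst) \<tau>s)"
  have univ: "fst x \<in> univ A" if "\<tau> \<in> set \<tau>s" "x \<in> set \<tau>" for \<tau> x
    using assms(1) that by (force simp: tuples_def in_univ_T)
  have "\<exists>p<m + length ?bs. (as @ ?bs) ! p = b" if "b \<in> set ?bs" for b
  proof -
    have "b \<in> set (as @ ?bs)" using that by simp
    then show ?thesis unfolding in_set_conv_nth using assms(2) by simp
  qed
  then obtain pos where pos: "\<And>b. b \<in> set ?bs \<Longrightarrow> pos b < m + length ?bs \<and> (as @ ?bs) ! pos b = b"
    by metis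
  let ?\<mu>s = "map (map (\<lambda>(b, c). (pos b, c))) \<tau>s"
  show ?thesis
  proof
    show "?bs \<in> lists (univ A)" using univ by auto
    show "length ?\<mu>s = k" using assms(1) by (simp add: tuples_def)
    have pos_fst: "pos (fst x) < m + length ?bs" "(as @ ?bs) ! pos (fst x) = fst x"
      if "\<tau> \<in> set \<tau>s" "x \<in> set \<tau>" for \<tau> x
      using that pos[of "fst x"] by auto
    show "set ?\<mu>s \<subseteq> node_codes (m + length ?bs)"
      using pos_fst(1) by (force simp: node_codes_def)
    show "map (node_at (as @ ?bs)) ?\<mu>s = \<tau>s"
      using pos_fst(2) by (auto simp: node_at_def split_def intro!: map_idI)
  qed
qed

lemma append_nodes_image:
  assumes as: "as \<in> tuples A m" and \<nu>s: "set \<nu>s \<subseteq> node_codes m"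
  shows "(@) (map (node_at as) \<nu>s) ` tuples T k =
    (\<Union>(l, \<mu>s)\<in>(SIGMA l:UNIV. {\<mu>s. length \<mu>s = k \<and> set \<mu>s \<subseteq> node_codes (m + l)}).
      (\<lambda>bs. map (node_at (as @ bs)) (\<nu>s @ \<mu>s)) ` tuples A l)"
    (is "?L = ?R")
proof
  have len: "length as = m" using as by (simp add: tuples_def)
  have append: "map (node_at (as @ bs)) (\<nu>s @ \<mu>s) =
      map (node_at as) \<nu>s @ map (node_at (as @ bs)) \<mu>s" for bs \<mu>s
    using \<nu>s node_at_append[OF len] by auto
  show "?L \<subseteq> ?R"
  proof (rule image_subsetI)
    fix \<tau>s assume \<tau>s: "\<tau>s \<in> tuples T k"
    obtain bs \<mu>s where bs: "bs \<in> lists (univ A)"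
      and \<mu>s: "length \<mu>s = k" "set \<mu>s \<subseteq> node_codes (m + length bs)"
      and "map (node_at (as @ bs)) \<mu>s = \<tau>s"
      by (rule ex_node_codes[OF \<tau>s len])
    then have "map (node_at as) \<nu>s @ \<tau>s = map (node_at (as @ bs)) (\<nu>s @ \<mu>s)" using append by simp
    moreover have "bs \<in> tuples A (length bs)" using bs by (simp add: tuples_def)
    ultimately show "map (node_at as) \<nu>s @ \<tau>s \<in> ?R" using \<mu>s by blast
  qed
  show "?R \<subseteq> ?L"
  proof
    fix \<sigma>s assume "\<sigma>s \<in> ?R"
    then obtain l \<mu>s bs where \<mu>s: "length \<mu>s = k" "set \<mu>s \<subseteq> node_codes (m + l)"
      and bs: "bs \<in> tuples A l"
      and \<sigma>s: "\<sigma>s = map (node_at as) \<nu>s @ map (node_at (as @ bs)) \<mu>s"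
      unfolding append by blast
    have "map (node_at (as @ bs)) \<mu>s \<in> tuples T k"
      using node_at_in_univ_T[OF tuples_append[OF as bs]] \<mu>s by (auto simp: tuples_def subset_iff)
    then show "\<sigma>s \<in> ?L" unfolding \<sigma>s by blast
  qed
qed

lemma qf_definable_nodes_atom_sat:
  assumes "length \<nu>s = n" "set \<nu>s \<subseteq> node_codes m" "atom_in tree_vocabulary a" "atom_vars a \<subseteq> {..<n}"
  shows "qf_definable V A m (\<lambda>as. atom_sat T ((!) (map (node_at as) \<nu>s)) a)"
proof -
  have code: "ancestor k (\<nu>s ! i) \<in> node_codes m" if "i < n" for i k
    using ancestor_in_node_codes nth_mem that assms(1,2) by blast
  from assms(3) show ?thesis
  proof (cases rule: atom_in_tree_vocabularyE)
    case (1 k i l j)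
    then show ?thesis
      using assms(1,4) qf_definable_node_at_eq[OF code code]
      by (simp add: atom_sat_T ancestor_node_at del: atom_sat.simps)
  next
    case (2 k i l j)
    then show ?thesis
      using assms(1,4) qf_definable_node_at_prefix[OF code code]
      by (simp add: atom_sat_T ancestor_node_at del: atom_sat.simps)
  next
    case (3 c k i)
    then have "set (map fst (ancestor k (\<nu>s ! i))) \<subseteq> {..<m}"
      using assms(4) code[of i k] by (force simp: node_codes_def)
    then show ?thesis
      using 3 assms(1,4) qf_definable_tuple_label
      by (simp add: atom_sat_T ancestor_node_at map_fst_node_at del: atom_sat.simps map_map)
  qed
qed

definition node_codings :: "nat \<Rightarrow> nat \<Rightarrow> ('a list \<Rightarrow> ('a \<times> nat) list list) set"
  where "node_codings m n =
    {\<lambda>as. map (node_at as) \<nu>s |\<nu>s. length \<nu>s = n \<and> set \<nu>s \<subseteq> node_codes m}"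

lemma tuple_coding_nodes: "tuple_coding V A tree_vocabulary T node_codings"
proof
  fix f and m n k :: nat
  assume "f \<in> node_codings m n"
  then obtain \<nu>s where f: "f = (\<lambda>as. map (node_at as) \<nu>s)"
    and \<nu>s: "length \<nu>s = n" "set \<nu>s \<subseteq> node_codes m"
    unfolding node_codings_def by blast
  show "f as \<in> tuples T n" if "as \<in> tuples A m" for as
    using node_at_in_univ_T[OF that] \<nu>s by (auto simp: f tuples_def subset_iff)
  show "qf_definable V A m (\<lambda>as. atom_sat T ((!) (f as)) a)"
    if "atom_in tree_vocabulary a" "atom_vars a \<subseteq> {..<n}" for a
    unfolding f using \<nu>s that by (rule qf_definable_nodes_atom_sat)
  let ?J = "SIGMA l:(UNIV :: nat set). {\<mu>s. length \<mu>s = k \<and> set \<mu>s \<subseteq> node_codes (m + l)}"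
  let ?I = "(\<lambda>(l, \<mu>s). (l, \<lambda>as. map (node_at as) (\<nu>s @ \<mu>s))) ` ?J"
  have "countable ?I" by simp
  moreover have "set \<nu>s \<subseteq> node_codes (m + l)" for l using \<nu>s(2) by (force simp: node_codes_def)
  then have "(\<lambda>as. map (node_at as) (\<nu>s @ \<mu>s)) \<in> node_codings (m + l) (n + k)"
    if "(l, \<mu>s) \<in> ?J" for l \<mu>s
    unfolding node_codings_def using that \<nu>s(1) by (intro CollectI exI[of _ "\<nu>s @ \<mu>s"]) simp
  then have "\<forall>(l, g)\<in>?I. g \<in> node_codings (m + l) (n + k)" by fast
  moreover have "covers_extensions A T m k f ?I"
    using append_nodes_image[OF _ \<nu>s(2)] by (simp add: covers_extensions_def f split_def)
  ultimately show "\<exists>I. countable I \<and> (\<forall>(l, g)\<in>I. g \<in> node_codings (m + l) (n + k)) \<and>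
      covers_extensions A T m k f I"
    by (intro exI[of _ ?I] conjI)
qed

theorem orbits_definable_of_tree:
  assumes "orbits_definable tree_vocabulary T \<alpha>"
  shows "orbits_definable V A \<alpha>"
  unfolding orbits_definable_def
proof
  fix as assume as: "as \<in> lists (univ A)"
  let ?n = "length as"
  let ?node = "\<lambda>bs :: 'a list. map (\<lambda>b. (b, 0 :: nat)) bs"
  have node: "?node bs \<in> univ T" if "bs \<in> tuples A ?n" for bs
    using that by (simp add: in_univ_T tuples_def comp_def)
  have as': "as \<in> tuples A ?n" using as by (simp add: tuples_def)
  let ?\<nu> = "map (\<lambda>i. (i, 0)) [0..<?n]"
  have "?\<nu> \<in> node_codes ?n" by (auto simp: node_codes_def)
  then have code: "(\<lambda>bs. map (node_at bs) [?\<nu>]) \<in> node_codings ?n 1"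
    unfolding node_codings_def by (intro CollectI exI[of _ "[?\<nu>]"]) simp
  have "Sigma_rel tree_vocabulary T \<alpha> 1 (orbit tree_vocabulary T [?node as])"
    using assms[unfolded orbits_definable_def, rule_format, of "[?node as]"] node[OF as'] by simp
  then have "Sigma_rel V A \<alpha> ?n
      {bs \<in> tuples A ?n. map (node_at bs) [?\<nu>] \<in> orbit tree_vocabulary T [?node as]}"
    using code by (rule tuple_coding.Sigma_rel_pullback[OF tuple_coding_nodes])
  moreover have "map (node_at bs) [?\<nu>] \<in> orbit tree_vocabulary T [?node as] \<longleftrightarrow> bs \<in> orbit V A as"
    if bs: "bs \<in> tuples A ?n" for bs
  proof -
    have "node_at bs ?\<nu> = ?node bs"
      using bs by (auto simp: node_at_def tuples_def intro: nth_equalityI)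
    then show ?thesis using orbit_node_iff[OF node[OF as'] node[OF bs]] by (simp add: comp_def)
  qed
  then have "{bs \<in> tuples A ?n. map (node_at bs) [?\<nu>] \<in> orbit tree_vocabulary T [?node as]} =
      orbit V A as"
    using orbit_subset[OF as'] by blast
  ultimately show "Sigma_rel V A \<alpha> ?n (orbit V A as)" by simp
qed

section \<open>From the structure to the tree\<close>

lemma qf_definable_ancestor_eq:
  assumes "i < m" "j < m"
  shows "qf_definable tree_vocabulary T m (\<lambda>\<sigma>s. ancestor k (\<sigma>s ! i) = ancestor l (\<sigma>s ! j))"
  using qf_definable_atom_sat[of tree_vocabulary
      "Eq (ancestor_tm k i) (ancestor_tm l j)" "\<lambda>i. i" m T] assms
  by (simp add: atom_sat_T del: atom_sat.simps)

lemma qf_definable_prefix: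
  assumes "i < m" "j < m"
  shows "qf_definable tree_vocabulary T m (\<lambda>\<sigma>s. prefix (\<sigma>s ! i) (\<sigma>s ! j))"
  using qf_definable_atom_sat[of tree_vocabulary
      "Rel Below [ancestor_tm 0 i, ancestor_tm 0 j]" "\<lambda>i. i" m T] assms
  by (simp add: atom_sat_T del: atom_sat.simps)

lemma qf_definable_label:
  assumes "i < m"
  shows "qf_definable tree_vocabulary T m (\<lambda>\<sigma>s. tuple_label e A (map fst (\<sigma>s ! i)) = c)"
  using qf_definable_atom_sat[of tree_vocabulary
      "Rel (Label c) [ancestor_tm 0 i]" "\<lambda>i. i" m T] assms
  by (simp add: atom_sat_T del: atom_sat.simps)

lemma qf_definable_diagram:
  assumes "i < m"
  shows "qf_definable tree_vocabulary T m
    (\<lambda>\<sigma>s. length (\<sigma>s ! i) = N \<and> D (finite_diagram e A (map fst (\<sigma>s ! i))))"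
proof -
  let ?D = "{d :: bool list. length d = N \<and> D d}"
  have "finite ?D"
    by (rule finite_subset[OF _ finite_lists_length_eq[of "UNIV :: bool set" N]]) auto
  then have "qf_definable tree_vocabulary T m
      (\<lambda>\<sigma>s. \<exists>d\<in>?D. tuple_label e A (map fst (\<sigma>s ! i)) = to_nat (N, d))"
    using assms by (intro qf_definable_Bex qf_definable_label)
  then show ?thesis
    by (rule qf_definable_cong) (auto simp: tuple_label_def finite_diagram_def)
qed

lemma qf_definable_length:
  "i < m \<Longrightarrow> qf_definable tree_vocabulary T m (\<lambda>\<sigma>s. length (\<sigma>s ! i) = N)"
  using qf_definable_diagram[of i m N "\<lambda>_. True"] by simp

text \<open>A quantifier-free condition on a tuple is not visible in the label of its node, but it is in the
  labels of all sufficiently long extensions of that node.\<close>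

lemma qf_definable_long_node_qf_sat:
  assumes "qf_in V p"
  shows "\<exists>N\<^sub>0. \<forall>N\<ge>N\<^sub>0. qf_definable tree_vocabulary T 1
    (\<lambda>\<sigma>s. length (\<sigma>s ! 0) = N \<and> qf_sat A ((!) (map fst (\<sigma>s ! 0))) p)"
    (is "\<exists>N\<^sub>0. \<forall>N\<ge>N\<^sub>0. ?def N p")
  using assms
proof (induction p)
  case Bot
  have "?def N Bot" for N using qf_definable_const[of tree_vocabulary T 1 False] by simp
  then show ?case by blast
next
  case (Atom a)
  then obtain j where j: "e j = a" using ex_enum by auto
  obtain b where b: "atom_vars a \<subseteq> {..<b}" using finite_nat_bounded[OF finite_atom_vars] by blast
  have "?def N (Atom a)" if N: "max b (Suc j) \<le> N" for N
  proof -
    have "atom_vars a \<subseteq> {..<N}" using b N by auto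
    then show ?thesis
      using N j by (intro qf_definable_cong[OF qf_definable_diagram[of 0 1 N "\<lambda>d. d ! j"]])
        (auto simp: finite_diagram_nth)
  qed
  then show ?case by blast
next
  case (Neg p)
  have "?def N (Neg p)" if "?def N p" for N
    using qf_definable_conj[OF qf_definable_length[of 0 1 N] qf_definable_not[OF that]]
    by (rule qf_definable_cong) auto
  then show ?case using Neg by auto
next
  case (And p q)
  have "?def N (And p q)" if "?def N p" "?def N q" for N
    using qf_definable_conj[OF that] by (rule qf_definable_cong) auto
  moreover obtain N\<^sub>1 N\<^sub>2 where "\<forall>N\<ge>N\<^sub>1. ?def N p" "\<forall>N\<ge>N\<^sub>2. ?def N q" using And by auto
  ultimately show ?case by (intro exI[of _ "max N\<^sub>1 N\<^sub>2"]) simp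
next
  case (Or p q)
  have "?def N (Or p q)" if "?def N p" "?def N q" for N
    using qf_definable_disj[OF that] by (rule qf_definable_cong) auto
  moreover obtain N\<^sub>1 N\<^sub>2 where "\<forall>N\<ge>N\<^sub>1. ?def N p" "\<forall>N\<ge>N\<^sub>2. ?def N q" using Or by auto
  ultimately show ?case by (intro exI[of _ "max N\<^sub>1 N\<^sub>2"]) simp
qed

definition nodes_over :: "nat \<Rightarrow> nat \<Rightarrow> 'a list set \<Rightarrow> ('a \<times> nat) list list set"
  where "nodes_over n N S = {\<sigma>s \<in> tuples T 1. length (\<sigma>s ! 0) = N \<and> take n (map fst (\<sigma>s ! 0)) \<in> S}"

lemma singleton_in_nodes_over_iff:
  "[\<sigma>] \<in> nodes_over n N S \<longleftrightarrow> \<sigma> \<in> univ T \<and> length \<sigma> = N \<and> take n (map fst \<sigma>) \<in> S"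
  by (auto simp: nodes_over_def tuples_def)

lemma Sigma_rel_zero_nodes_over:
  assumes "Sigma_rel V A 0 n S"
  shows "\<exists>N\<ge>n. Sigma_rel tree_vocabulary T 0 1 (nodes_over n N S)"
proof -
  have "qf_definable V A n (\<lambda>as. as \<in> S)" using assms by (simp add: Sigma_rel_zero_iff)
  then obtain p where p: "qf_in V p" "qf_vars p \<subseteq> {..<n}"
    and S: "\<forall>as\<in>tuples A n. qf_sat A ((!) as) p \<longleftrightarrow> as \<in> S"
    by (rule qf_definableE)
  obtain N where N: "n \<le> N" and qf: "qf_definable tree_vocabulary T 1
      (\<lambda>\<sigma>s. length (\<sigma>s ! 0) = N \<and> qf_sat A ((!) (map fst (\<sigma>s ! 0))) p)"
    using qf_definable_long_node_qf_sat[OF p(1)] by (meson max.cobounded1 max.cobounded2)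
  have "qf_sat A ((!) (map fst \<sigma>)) p \<longleftrightarrow> take n (map fst \<sigma>) \<in> S"
    if \<sigma>: "\<sigma> \<in> univ T" "length \<sigma> = N" for \<sigma>
  proof -
    have "qf_sat A ((!) (map fst \<sigma>)) p \<longleftrightarrow> qf_sat A ((!) (take n (map fst \<sigma>))) p"
      using p(2) by (intro qf_sat_cong) auto
    moreover have "map fst \<sigma> \<in> tuples A N" using \<sigma> unfolding in_univ_T tuples_def by simp
    then have "take n (map fst \<sigma>) \<in> tuples A n" using N by (rule take_in_tuples)
    ultimately show ?thesis using S by blast
  qed
  then have "{\<sigma>s \<in> tuples T 1. length (\<sigma>s ! 0) = N \<and> qf_sat A ((!) (map fst (\<sigma>s ! 0))) p} =
      nodes_over n N S"
    by (auto simp: nodes_over_def tuples_Suc_0_iff)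
  then show ?thesis using Sigma_rel_0[OF qf] N by auto
qed

lemma Bex_extension_iff_Bex_tuples:
  assumes \<sigma>: "\<sigma> \<in> univ T" "length \<sigma> = n" and N: "n + k \<le> N"
  shows "(\<exists>\<tau>\<in>univ T. prefix \<sigma> \<tau> \<and> length \<tau> = N \<and> P (take (n + k) (map fst \<tau>))) \<longleftrightarrow>
    (\<exists>bs\<in>tuples A k. P (map fst \<sigma> @ bs))"
    (is "?L \<longleftrightarrow> ?R")
proof
  assume ?L
  then obtain \<upsilon> where \<upsilon>: "\<sigma> @ \<upsilon> \<in> univ T" "length (\<sigma> @ \<upsilon>) = N" "P (take (n + k) (map fst (\<sigma> @ \<upsilon>)))"
    by (auto simp: prefix_def)
  have "map fst \<upsilon> \<in> tuples A (N - n)" using \<upsilon>(1,2) \<sigma>(2) by (auto simp: in_univ_T tuples_def)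
  then have "take k (map fst \<upsilon>) \<in> tuples A k" by (rule take_in_tuples) (use N in linarith)
  moreover have "take (n + k) (map fst (\<sigma> @ \<upsilon>)) = map fst \<sigma> @ take k (map fst \<upsilon>)" using \<sigma>(2) by simp
  ultimately show ?R using \<upsilon>(3) by metis
next
  assume ?R
  then obtain bs where bs: "bs \<in> tuples A k" "P (map fst \<sigma> @ bs)" by blast
  obtain a where a: "a \<in> univ A" using model by (auto simp: is_model_def)
  let ?\<tau> = "\<sigma> @ map (\<lambda>b. (b, 0)) (bs @ replicate (N - (n + k)) a)"
  have map_\<tau>: "map fst ?\<tau> = map fst \<sigma> @ bs @ replicate (N - (n + k)) a" by (simp add: comp_def)
  have "?\<tau> \<in> univ T"
    unfolding in_univ_T map_\<tau> using \<sigma>(1) bs(1) a by (auto simp: in_univ_T tuples_def)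
  moreover have "length ?\<tau> = N" "take (n + k) (map fst ?\<tau>) = map fst \<sigma> @ bs"
    using \<sigma>(2) bs(1) N unfolding map_\<tau> by (simp_all add: tuples_def)
  moreover have "prefix \<sigma> ?\<tau>" by simp
  ultimately show ?L using bs(2) by metis
qed

definition extensions_within :: "nat \<Rightarrow> nat \<Rightarrow> nat \<Rightarrow> 'a list set \<Rightarrow> ('a \<times> nat) list list set"
  where "extensions_within n k N R = {\<sigma>s \<in> tuples T 2.
    length (\<sigma>s ! 0) = n \<and> prefix (\<sigma>s ! 0) (\<sigma>s ! 1) \<and> length (\<sigma>s ! 1) = N \<longrightarrow>
      take (n + k) (map fst (\<sigma>s ! 1)) \<in> R}"

lemma Sigma_rel_extensions_within:
  assumes "Sigma_rel tree_vocabulary T \<alpha> 1 (nodes_over (n + k) N R)"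
  shows "Sigma_rel tree_vocabulary T \<alpha> 2 (extensions_within n k N R)"
proof -
  let ?ext = "\<lambda>\<sigma>s. length (\<sigma>s ! 0) = n \<and> prefix (\<sigma>s ! 0) (\<sigma>s ! 1) \<and> length (\<sigma>s ! 1) = N"
  let ?within = "{\<sigma>s \<in> tuples T 2. map ((!) \<sigma>s) [1] \<in> nodes_over (n + k) N R}"
  have "Sigma_rel tree_vocabulary T 0 2 {\<sigma>s \<in> tuples T 2. \<not> ?ext \<sigma>s}"
    by (intro Sigma_rel_0 qf_definable_not qf_definable_conj[OF qf_definable_length]
        qf_definable_conj[OF qf_definable_prefix] qf_definable_length) simp_all
  then have "Sigma_rel tree_vocabulary T \<alpha> 2 {\<sigma>s \<in> tuples T 2. \<not> ?ext \<sigma>s}"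
    by (rule Sigma_rel_mono) simp
  moreover have "Sigma_rel tree_vocabulary T \<alpha> 2 ?within"
    by (rule Sigma_rel_reindex[OF assms]) simp_all
  ultimately have "Sigma_rel tree_vocabulary T \<alpha> 2 ({\<sigma>s \<in> tuples T 2. \<not> ?ext \<sigma>s} \<union> ?within)"
    by (rule Sigma_rel_Un)
  moreover have "map ((!) \<sigma>s) [1] \<in> nodes_over (n + k) N R \<longleftrightarrow>
      length (\<sigma>s ! 1) = N \<and> take (n + k) (map fst (\<sigma>s ! 1)) \<in> R" if "\<sigma>s \<in> tuples T 2" for \<sigma>s
    using nth_in_univ[OF that, of 1] by (simp add: singleton_in_nodes_over_iff)
  then have "{\<sigma>s \<in> tuples T 2. \<not> ?ext \<sigma>s} \<union> ?within = extensions_within n k N R"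
    unfolding extensions_within_def by blast
  ultimately show ?thesis by simp
qed

lemma Bex_notin_extensions_within_iff:
  assumes \<sigma>: "\<sigma> \<in> univ T" and N: "n + k \<le> N"
  shows "(\<exists>\<tau>s\<in>tuples T 1. [\<sigma>] @ \<tau>s \<notin> extensions_within n k N R) \<longleftrightarrow>
    length \<sigma> = n \<and> (\<exists>bs\<in>tuples A k. map fst \<sigma> @ bs \<notin> R)"
proof -
  have "[\<sigma>, \<tau>] \<in> tuples T 2" if "\<tau> \<in> univ T" for \<tau> using \<sigma> that by (simp add: tuples_def)
  then have "(\<exists>\<tau>s\<in>tuples T 1. [\<sigma>] @ \<tau>s \<notin> extensions_within n k N R) \<longleftrightarrow> length \<sigma> = n \<and>
      (\<exists>\<tau>\<in>univ T. prefix \<sigma> \<tau> \<and> length \<tau> = N \<and> take (n + k) (map fst \<tau>) \<notin> R)"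
    by (auto simp: Bex_tuples_Suc_0 extensions_within_def)
  also have "\<dots> \<longleftrightarrow> length \<sigma> = n \<and> (\<exists>bs\<in>tuples A k. map fst \<sigma> @ bs \<notin> R)"
    using Bex_extension_iff_Bex_tuples[OF \<sigma> _ N, of "\<lambda>as. as \<notin> R"] by blast
  finally show ?thesis .
qed

lemma nodes_over_ext_outside:
  assumes N: "\<And>i. n + k i \<le> N i"
  shows "nodes_over n n (ext_outside A n I k R) =
    ext_outside T 1 I (\<lambda>_. 1) (\<lambda>i. extensions_within n (k i) (N i) (R i))"
    (is "?L = ?R")
proof -
  have singleton: "[\<sigma>] \<in> ?L \<longleftrightarrow> [\<sigma>] \<in> ?R" if \<sigma>: "\<sigma> \<in> univ T" for \<sigma>
  proof -
    have "[\<sigma>] \<in> tuples T 1" using \<sigma> by (simp add: tuples_def)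
    then have "[\<sigma>] \<in> ?R \<longleftrightarrow> length \<sigma> = n \<and> (\<exists>i\<in>I. \<exists>bs\<in>tuples A (k i). map fst \<sigma> @ bs \<notin> R i)"
      unfolding ext_outside_def mem_Collect_eq Bex_notin_extensions_within_iff[OF \<sigma> N] by blast
    moreover have "map fst \<sigma> \<in> tuples A n \<longleftrightarrow> length \<sigma> = n"
      using \<sigma> by (simp add: in_univ_T tuples_def)
    ultimately show ?thesis
      using \<sigma> by (cases "length \<sigma> = n") (simp_all add: singleton_in_nodes_over_iff ext_outside_def)
  qed
  show ?thesis
  proof (rule set_eqI)
    fix \<sigma>s
    show "\<sigma>s \<in> ?L \<longleftrightarrow> \<sigma>s \<in> ?R"
    proof (cases "\<sigma>s \<in> tuples T 1")
      case True
      then obtain \<sigma> where "\<sigma> \<in> univ T" "\<sigma>s = [\<sigma>]" unfolding One_nat_def tuples_Suc_0_iff by blast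
      then show ?thesis using singleton by blast
    next
      case False
      then show ?thesis unfolding nodes_over_def ext_outside_def by blast
    qed
  qed
qed

lemma Sigma_rel_nodes_over:
  assumes "Sigma_rel V A \<alpha> n S"
  shows "\<exists>N\<ge>n. (0 < \<alpha> \<longrightarrow> N = n) \<and> Sigma_rel tree_vocabulary T \<alpha> 1 (nodes_over n N S)"
  using assms
proof (induction rule: Sigma_rel.induct)
  case (Sigma_rel_0 n P)
  then show ?case using Sigma_rel_zero_nodes_over[OF Sigma_rel.Sigma_rel_0] by simp
next
  case (Sigma_rel_step \<alpha> n k R)
  have "\<forall>i. \<exists>N. n + k i \<le> N \<and> (\<exists>\<beta><\<alpha>. Sigma_rel tree_vocabulary T \<beta> 1 (nodes_over (n + k i) N (R i)))"
    using Sigma_rel_step.IH by blast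
  from choice[OF this] obtain N where
    N: "n + k i \<le> N i" "\<exists>\<beta><\<alpha>. Sigma_rel tree_vocabulary T \<beta> 1 (nodes_over (n + k i) (N i) (R i))" for i
    by blast
  have "\<exists>\<beta><\<alpha>. Sigma_rel tree_vocabulary T \<beta> (1 + 1) (extensions_within n (k i) (N i) (R i))" for i
    using N(2)[of i] Sigma_rel_extensions_within unfolding one_add_one by blast
  from Sigma_rel.Sigma_rel_step[OF \<open>0 < \<alpha>\<close> this]
  have "Sigma_rel tree_vocabulary T \<alpha> 1 (nodes_over n n (ext_outside A n UNIV k R))"
    using nodes_over_ext_outside[of n k N UNIV R] N(1) by simp
  then show ?case by blast
qed

lemma Sigma_rel_nodes:
  assumes "Sigma_rel V A \<alpha> n S" "0 < \<alpha>"
  shows "Sigma_rel tree_vocabulary T \<alpha> 1 {\<sigma>s \<in> tuples T 1. map fst (\<sigma>s ! 0) \<in> S}"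
proof -
  have "length \<sigma> = n \<and> take n (map fst \<sigma>) \<in> S \<longleftrightarrow> map fst \<sigma> \<in> S" for \<sigma> :: "('a \<times> nat) list"
    using Sigma_rel_subset[OF assms(1)] by (auto simp: tuples_def)
  then have "{\<sigma>s \<in> tuples T 1. map fst (\<sigma>s ! 0) \<in> S} = nodes_over n n S"
    unfolding nodes_over_def by simp
  then show ?thesis using Sigma_rel_nodes_over[OF assms(1)] assms(2) by auto
qed

lemma tree_sim_zip_iff:
  assumes \<sigma>s: "\<sigma>s \<in> tuples T m" and \<tau>s: "\<tau>s \<in> tuples T m" and N: "\<And>\<sigma>. \<sigma> \<in> set \<sigma>s \<Longrightarrow> length \<sigma> \<le> N"
  shows "tree_sim (set (zip \<sigma>s \<tau>s)) \<longleftrightarrow>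
    (\<forall>i<m. map fst (\<tau>s ! i) \<in> orbit V A (map fst (\<sigma>s ! i))) \<and>
    (\<forall>i<m. \<forall>j<m. \<forall>k\<le>N. \<forall>l\<le>N. ancestor k (\<sigma>s ! i) = ancestor l (\<sigma>s ! j) \<longleftrightarrow>
      ancestor k (\<tau>s ! i) = ancestor l (\<tau>s ! j))"
    (is "_ \<longleftrightarrow> ?orbits \<and> ?bounded")
proof -
  let ?unbounded = "\<forall>i<m. \<forall>j<m. \<forall>k l. ancestor k (\<sigma>s ! i) = ancestor l (\<sigma>s ! j) \<longleftrightarrow>
      ancestor k (\<tau>s ! i) = ancestor l (\<tau>s ! j)"
  have len: "length \<sigma>s = m" "length \<tau>s = m" using \<sigma>s \<tau>s by (simp_all add: tuples_def)
  then have zip: "set (zip \<sigma>s \<tau>s) = (\<lambda>i. (\<sigma>s ! i, \<tau>s ! i)) ` {..<m}" by (auto simp: set_zip)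
  have "tree_sim (set (zip \<sigma>s \<tau>s)) \<longleftrightarrow> ?orbits \<and> ?unbounded"
    using nth_in_univ[OF \<sigma>s] nth_in_univ[OF \<tau>s] unfolding tree_sim_def zip by auto
  moreover have ?unbounded if ?orbits ?bounded
  proof (intro allI impI)
    fix i j k l assume ij: "i < m" "j < m"
    have trunc: "ancestor (min k N) (\<sigma>s ! i) = ancestor k (\<sigma>s ! i)"
      "ancestor (min k N) (\<tau>s ! i) = ancestor k (\<tau>s ! i)"
      if "i < m" for i k
    proof -
      have "length (\<tau>s ! i) = length (\<sigma>s ! i)" using orbit_length \<open>?orbits\<close> that by fastforce
      moreover have "length (\<sigma>s ! i) \<le> N" using N that len by simp
      ultimately show "ancestor (min k N) (\<sigma>s ! i) = ancestor k (\<sigma>s ! i)"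
        "ancestor (min k N) (\<tau>s ! i) = ancestor k (\<tau>s ! i)"
        by (simp_all add: ancestor_eq_ancestor_iff min_def)
    qed
    show "ancestor k (\<sigma>s ! i) = ancestor l (\<sigma>s ! j) \<longleftrightarrow> ancestor k (\<tau>s ! i) = ancestor l (\<tau>s ! j)"
      using \<open>?bounded\<close>[rule_format, OF ij, of "min k N" "min l N"]
      by (simp add: trunc[OF ij(1)] trunc[OF ij(2)])
  qed
  ultimately show ?thesis by blast
qed

lemma Sigma_rel_node_orbits:
  assumes "orbits_definable V A \<alpha>" "0 < \<alpha>" and \<sigma>s: "\<sigma>s \<in> tuples T m"
  shows "Sigma_rel tree_vocabulary T \<alpha> m
    {\<tau>s \<in> tuples T m. \<forall>i\<in>{..<m}. map fst (\<tau>s ! i) \<in> orbit V A (map fst (\<sigma>s ! i))}"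
proof -
  let ?node = "\<lambda>i. {\<tau>s \<in> tuples T 1. map fst (\<tau>s ! 0) \<in> orbit V A (map fst (\<sigma>s ! i))}"
  let ?O = "\<lambda>i. {\<tau>s \<in> tuples T m. map ((!) \<tau>s) [i] \<in> ?node i}"
  have "Sigma_rel tree_vocabulary T \<alpha> m (?O i)" if i: "i < m" for i
  proof (rule Sigma_rel_reindex)
    have "map fst (\<sigma>s ! i) \<in> lists (univ A)" using nth_in_univ[OF \<sigma>s i] unfolding in_univ_T .
    then have "Sigma_rel V A \<alpha> (length (map fst (\<sigma>s ! i))) (orbit V A (map fst (\<sigma>s ! i)))"
      using assms(1) unfolding orbits_definable_def by blast
    then show "Sigma_rel tree_vocabulary T \<alpha> 1 (?node i)" using assms(2) by (rule Sigma_rel_nodes)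
  qed (use i in simp_all)
  then have "Sigma_rel tree_vocabulary T \<alpha> m {\<tau>s \<in> tuples T m. \<forall>i\<in>{..<m}. \<tau>s \<in> ?O i}"
    by (intro Sigma_rel_Ball) simp_all
  moreover have "\<tau>s \<in> ?O i \<longleftrightarrow> map fst (\<tau>s ! i) \<in> orbit V A (map fst (\<sigma>s ! i))"
    if "\<tau>s \<in> tuples T m" "i < m" for \<tau>s i
    using that nth_in_univ[OF that] by (simp add: tuples_Suc_0_iff)
  then have "{\<tau>s \<in> tuples T m. \<forall>i\<in>{..<m}. \<tau>s \<in> ?O i} =
      {\<tau>s \<in> tuples T m. \<forall>i\<in>{..<m}. map fst (\<tau>s ! i) \<in> orbit V A (map fst (\<sigma>s ! i))}"
    by blast
  ultimately show ?thesis by simp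
qed

theorem orbits_definable_in_tree:
  assumes "orbits_definable V A \<alpha>" "0 < \<alpha>"
  shows "orbits_definable tree_vocabulary T \<alpha>"
  unfolding orbits_definable_def
proof
  fix \<sigma>s assume "\<sigma>s \<in> lists (univ T)"
  let ?m = "length \<sigma>s"
  have \<sigma>s: "\<sigma>s \<in> tuples T ?m" using \<open>\<sigma>s \<in> lists (univ T)\<close> by (simp add: tuples_def)
  define N where "N = sum_list (map length \<sigma>s)"
  have N: "length \<sigma> \<le> N" if "\<sigma> \<in> set \<sigma>s" for \<sigma>
    unfolding N_def using that by (intro member_le_sum_list) simp_all
  let ?orbits = "{\<tau>s \<in> tuples T ?m. \<forall>i\<in>{..<?m}. map fst (\<tau>s ! i) \<in> orbit V A (map fst (\<sigma>s ! i))}"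
  let ?meets = "{\<tau>s \<in> tuples T ?m. \<forall>i\<in>{..<?m}. \<forall>j\<in>{..<?m}. \<forall>k\<in>{..N}. \<forall>l\<in>{..N}.
      ancestor k (\<sigma>s ! i) = ancestor l (\<sigma>s ! j) \<longleftrightarrow> ancestor k (\<tau>s ! i) = ancestor l (\<tau>s ! j)}"
  have "Sigma_rel tree_vocabulary T 0 ?m ?meets"
    by (intro Sigma_rel_0 qf_definable_Ball qf_definable_iff qf_definable_const
        qf_definable_ancestor_eq) simp_all
  then have "Sigma_rel tree_vocabulary T \<alpha> ?m ?meets" by (rule Sigma_rel_mono) simp
  with Sigma_rel_node_orbits[OF assms \<sigma>s]
  have "Sigma_rel tree_vocabulary T \<alpha> ?m (?orbits \<inter> ?meets)" by (rule Sigma_rel_Int)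
  moreover have "\<tau>s \<in> orbit tree_vocabulary T \<sigma>s \<longleftrightarrow> \<tau>s \<in> ?orbits \<inter> ?meets"
    if \<tau>s: "\<tau>s \<in> tuples T ?m" for \<tau>s
    using orbit_tree_iff[OF \<sigma>s] \<tau>s tree_sim_zip_iff[OF \<sigma>s \<tau>s N] by (simp add: Ball_def)
  then have "orbit tree_vocabulary T \<sigma>s = ?orbits \<inter> ?meets"
    using orbit_subset[OF \<sigma>s] by blast
  ultimately show "Sigma_rel tree_vocabulary T \<alpha> ?m (orbit tree_vocabulary T \<sigma>s)" by simp
qed

end

theorem mainTheorem10:
  fixes V :: "('f, 'r) vocabulary" and A :: "('a, 'f, 'r) model"
    and e :: "nat \<Rightarrow> ('f, 'r) atom"
  assumes "countable_vocabulary V"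
    and "is_model V A" and "countable (univ A)"
    and "enumerates_atoms V e"
  shows "(scott_rank V A \<noteq> 0 \<longrightarrow>
            scott_rank V A = scott_rank tree_vocabulary (tree_of_tuples e A)) \<and>
         (scott_rank V A = 0 \<longrightarrow>
            scott_rank tree_vocabulary (tree_of_tuples e A) \<le> 1)"
proof -
  interpret tuple_tree V A e using assms(2-4) by unfold_locales
  let ?P = "orbits_definable V A" and ?Q = "orbits_definable tree_vocabulary T"
  show ?thesis
  proof (cases "?P 0")
    case True
    then have "?P 1" by (rule orbits_definable_mono) simp
    then have "?Q 1" using omega1_zero_less_one by (rule orbits_definable_in_tree)
    then have "Least ?Q \<le> 1" by (rule Least_le)
    moreover have "Least ?P = 0" using True Least_le[of ?P 0] by (simp add: antisym)
    ultimately show ?thesis by (simp add: scott_rank_eq_Least)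
  next
    case False
    then have "?P \<alpha> = ?Q \<alpha>" for \<alpha>
      using orbits_definable_of_tree orbits_definable_in_tree
      by (cases "\<alpha> = 0") (auto simp: omega1_pos_iff)
    then have "?P = ?Q" by (rule ext)
    then show ?thesis by (simp add: scott_rank_eq_Least)
  qed
qed

end
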